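(* For every fixed integer $t\ge 2$ there exist constants $C\ge 0$ and $r_0$ (depending only on $t$) such that for all integers $r\ge r_0$, \[F(r,t)\ge \left(\frac{t^t}{(t-1)^{t-1}}\right)^{r-C\sqrt{r}}.\]
   Context: An $r$-uniform hypergraph is a hypergraph all of whose edges have exactly $r$ vertices. A matching is a collection of pairwise disjoint edges; its size is the number of edges. Given matchings $M_1,\dots,M_N$ in the same hypergraph, a rainbow matching of size $t$ consists of pairwise disjoint edges $e_1\in M_{i_1},\dots,e_t\in M_{i_t}$ with distinct indices $i_1,\dots,i_t\in\{1,\dots,N\}$. $F(r,t)$ denotes the maximum possible number $N$ of matchings $M_1,\dots,M_N$ of size $t$ in some $r$-uniform hypergraph such that there is no rainbow matching of size $t$. *)

theory Defs
  imports Complex_Main "HOL-Library.Disjoint_Sets"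
begin

definition uniform_hypergraph :: "nat \<Rightarrow> 'v set \<Rightarrow> 'v set set \<Rightarrow> bool" where
  "uniform_hypergraph r V E \<longleftrightarrow> finite V \<and> (\<forall>e\<in>E. e \<subseteq> V \<and> card e = r)"

definition matching :: "'v set set \<Rightarrow> 'v set set \<Rightarrow> bool" where
  "matching E M \<longleftrightarrow> M \<subseteq> E \<and> disjoint M"

definition has_rainbow_matching :: "nat \<Rightarrow> (nat \<Rightarrow> 'v set set) \<Rightarrow> nat \<Rightarrow> bool" where
  "has_rainbow_matching N M t \<longleftrightarrow>
     (\<exists>i e. i ` {1..t} \<subseteq> {1..N} \<and> inj_on i {1..t} \<and>
            (\<forall>k\<in>{1..t}. e k \<in> M (i k)) \<and> disjoint_family_on e {1..t})"

text \<open>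
  The matchings \<open>M 1, \<dots>, M N\<close> need not be distinct. Taking the vertices to be
  natural numbers is no restriction: the vertex set is finite, so any hypergraph
  can be relabelled.
\<close>

definition rainbow_free_number :: "nat \<Rightarrow> nat \<Rightarrow> nat \<Rightarrow> bool" where
  "rainbow_free_number r t N \<longleftrightarrow>
     (\<exists>(V :: nat set) E M. uniform_hypergraph r V E \<and>
        (\<forall>i\<in>{1..N}. matching E (M i) \<and> card (M i) = t) \<and>
        \<not> has_rainbow_matching N M t)"

definition F :: "nat \<Rightarrow> nat \<Rightarrow> nat" where
  "F r t = Max {N. rainbow_free_number r t N}"

text \<open>
  The rest of this theory shows that the maximum in the definition of \<open>F\<close> exists
  for \<open>t \<ge> 1\<close>. A matching with enumerated edges is encoded as the partial map sending
  a covered vertex to the number of its edge; among sufficiently many such maps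
  there are \<open>p\<close> that pairwise agree wherever both are defined.
\<close>

lemma compatible_maps:
  "\<exists>B. \<forall>I (f :: nat \<Rightarrow> 'v \<Rightarrow> nat option).
     finite I \<and> (\<forall>i\<in>I. finite (dom (f i)) \<and> card (dom (f i)) \<le> k \<and> ran (f i) \<subseteq> {1..t}) \<and> B < card I
     \<longrightarrow> (\<exists>J\<subseteq>I. card J = p \<and> (\<forall>i\<in>J. \<forall>j\<in>J. \<forall>v\<in>dom (f i) \<inter> dom (f j). f i v = f j v))"
proof (induction k)
  case 0
  show ?case
  proof (intro exI[of _ p] allI impI)
    fix I and f :: "nat \<Rightarrow> 'v \<Rightarrow> nat option"
    assume *: "finite I \<and> (\<forall>i\<in>I. finite (dom (f i)) \<and> card (dom (f i)) \<le> 0 \<and> ran (f i) \<subseteq> {1..t}) \<and> p < card I"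
    then obtain J where J: "J \<subseteq> I" "card J = p"
      by (meson less_imp_le obtain_subset_with_card_n)
    have "dom (f i) = {}" if "i \<in> J" for i
      using * J that by (metis card_0_eq le_zero_eq subsetD)
    then have "\<forall>i\<in>J. \<forall>j\<in>J. \<forall>v\<in>dom (f i) \<inter> dom (f j). f i v = f j v"
      by (metis Int_iff empty_iff)
    with J show "\<exists>J\<subseteq>I. card J = p \<and> (\<forall>i\<in>J. \<forall>j\<in>J. \<forall>v\<in>dom (f i) \<inter> dom (f j). f i v = f j v)"
      by blast
  qed
next
  case (Suc k)
  then obtain B where B: "\<And>I (f :: nat \<Rightarrow> 'v \<Rightarrow> nat option).
     finite I \<Longrightarrow> (\<And>i. i\<in>I \<Longrightarrow> finite (dom (f i)) \<and> card (dom (f i)) \<le> k \<and> ran (f i) \<subseteq> {1..t}) \<Longrightarrow> B < card I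
     \<Longrightarrow> (\<exists>J\<subseteq>I. card J = p \<and> (\<forall>i\<in>J. \<forall>j\<in>J. \<forall>v\<in>dom (f i) \<inter> dom (f j). f i v = f j v))"
    by metis
  show ?case
  proof (intro exI[of _ "p + p * Suc k * t * B"] allI impI)
    fix I and f :: "nat \<Rightarrow> 'v \<Rightarrow> nat option"
    assume *: "finite I \<and> (\<forall>i\<in>I. finite (dom (f i)) \<and> card (dom (f i)) \<le> Suc k \<and> ran (f i) \<subseteq> {1..t}) \<and>
       p + p * Suc k * t * B < card I"
    let ?goal = "\<exists>J\<subseteq>I. card J = p \<and> (\<forall>i\<in>J. \<forall>j\<in>J. \<forall>v\<in>dom (f i) \<inter> dom (f j). f i v = f j v)"
    define S where "S = {J. J \<subseteq> I \<and> disjoint_family_on (\<lambda>i. dom (f i)) J}"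
    have "finite S" "S \<noteq> {}"
      using * by (auto simp: S_def disjoint_family_on_def)
    then obtain D where D: "D \<in> S" and Dmax: "\<And>J. J \<in> S \<Longrightarrow> D \<subseteq> J \<Longrightarrow> J = D"
      by (metis finite_has_maximal)
    have DI: "D \<subseteq> I" and finD: "finite D"
      using D * finite_subset by (auto simp: S_def)
    show ?goal
    proof (cases "p \<le> card D")
      case True
      then obtain J where J: "J \<subseteq> D" "card J = p"
        by (meson obtain_subset_with_card_n)
      have "dom (f i) \<inter> dom (f j) = {}" if "i \<in> J" "j \<in> J" "i \<noteq> j" for i j
      proof -
        have "disjoint_family_on (\<lambda>i. dom (f i)) D" "i \<in> D" "j \<in> D"
          using D J(1) that by (auto simp: S_def)
        then show ?thesis
          using that(3) by (rule disjoint_family_onD)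
      qed
      then have "\<forall>i\<in>J. \<forall>j\<in>J. \<forall>v\<in>dom (f i) \<inter> dom (f j). f i v = f j v"
        by (metis empty_iff)
      then show ?thesis
        using J(2) order_trans[OF J(1) DI] by (intro exI[of _ J] conjI)
    next
      case False
      define W where "W = (\<Union>i\<in>D. dom (f i))"
      have finW: "finite W"
        using * DI finD by (auto simp: W_def)
      have "card W \<le> (\<Sum>i\<in>D. card (dom (f i)))"
        unfolding W_def using finD by (rule card_UN_le)
      also have "\<dots> \<le> (\<Sum>i\<in>D. Suc k)"
        using * DI by (intro sum_mono) auto
      also have "\<dots> \<le> p * Suc k"
        using False by (simp only: sum_constant of_nat_id) (intro mult_right_mono, auto)
      finally have cW: "card W \<le> p * Suc k" .
      define T where "T = (\<lambda>(v, c). {i \<in> I. f i v = Some c})"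
      have cover: "I \<subseteq> D \<union> (\<Union>x\<in>W \<times> {1..t}. T x)"
      proof
        fix i assume i: "i \<in> I"
        show "i \<in> D \<union> (\<Union>x\<in>W \<times> {1..t}. T x)"
        proof (cases "i \<in> D")
          case False
          then have "insert i D \<notin> S"
            using Dmax by blast
          moreover have "insert i D \<in> S" if "dom (f i) \<inter> (\<Union>j\<in>D. dom (f j)) = {}"
            using D i disjoint_family_on_insert[OF False, of "\<lambda>i. dom (f i)"] that
            unfolding S_def by blast
          ultimately obtain j where "j \<in> D" "dom (f i) \<inter> dom (f j) \<noteq> {}"
            by blast
          then obtain v c where "v \<in> W" "f i v = Some c"
            by (auto simp: W_def)
          moreover from this have "c \<in> {1..t}"
            using * i by (meson ranI subsetD)
          ultimately show ?thesis
            using i by (auto simp: T_def)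
        qed auto
      qed
      have "\<exists>x\<in>W \<times> {1..t}. B < card (T x)"
      proof (rule ccontr)
        assume "\<not> ?thesis"
        then have small: "\<And>x. x \<in> W \<times> {1..t} \<Longrightarrow> card (T x) \<le> B"
          by (meson not_less)
        have finT: "finite (T x)" for x
          using * by (cases x) (auto simp: T_def)
        have "card I \<le> card (D \<union> (\<Union>x\<in>W \<times> {1..t}. T x))"
          using cover finD finW finT by (intro card_mono) auto
        also have "\<dots> \<le> card D + card (\<Union>x\<in>W \<times> {1..t}. T x)"
          by (rule card_Un_le)
        finally have le: "card I \<le> card D + card (\<Union>x\<in>W \<times> {1..t}. T x)" .
        have "card (\<Union>x\<in>W \<times> {1..t}. T x) \<le> (\<Sum>x\<in>W \<times> {1..t}. card (T x))"
          using finW by (intro card_UN_le) auto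
        also have "\<dots> \<le> (\<Sum>x\<in>W \<times> {1..t}. B)"
          using small by (intro sum_mono) auto
        also have "\<dots> = card W * t * B"
          by (simp add: card_cartesian_product)
        also have "\<dots> \<le> p * Suc k * t * B"
          using cW by (intro mult_right_mono) auto
        finally show False
          using le * False by linarith
      qed
      then obtain v c where vc: "B < card (T (v, c))"
        by auto
      define g where "g = (\<lambda>i. (f i)(v := None))"
      have "finite (dom (g i)) \<and> card (dom (g i)) \<le> k \<and> ran (g i) \<subseteq> {1..t}" if "i \<in> T (v, c)" for i
      proof -
        have i: "i \<in> I" "v \<in> dom (f i)"
          using that by (auto simp: T_def)
        have "dom (g i) = dom (f i) - {v}"
          by (auto simp: g_def)
        moreover have "ran (g i) \<subseteq> ran (f i)"
          by (auto simp: g_def ran_def)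
        moreover have "card (dom (f i) - {v}) = card (dom (f i)) - 1"
          using i * by (simp add: card_Diff_singleton)
        ultimately show ?thesis
          using * i by fastforce
      qed
      moreover have "finite (T (v, c))"
        using * by (auto simp: T_def)
      ultimately obtain J where J: "J \<subseteq> T (v, c)" "card J = p"
        and Jg: "\<And>i j u. i \<in> J \<Longrightarrow> j \<in> J \<Longrightarrow> u \<in> dom (g i) \<inter> dom (g j) \<Longrightarrow> g i u = g j u"
        using B[of "T (v, c)" g] vc by blast
      have Jf: "f i u = f j u" if "i \<in> J" "j \<in> J" "u \<in> dom (f i) \<inter> dom (f j)" for i j u
      proof (cases "u = v")
        case True
        have "i \<in> T (v, c)" "j \<in> T (v, c)"
          using that(1,2) J(1) by blast+
        with True show ?thesis by (simp add: T_def)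
      next
        case False
        then show ?thesis using that Jg[of i j u] by (auto simp: g_def)
      qed
      have "J \<subseteq> I"
        using J(1) by (auto simp: T_def)
      then show ?thesis
        using J(2) Jf by (intro exI[of _ J] conjI ballI)
    qed
  qed
qed

lemma finite_rainbow_free_numbers: "finite {N. rainbow_free_number r t N}"
proof -
  obtain B where B: "\<And>I (f :: nat \<Rightarrow> nat \<Rightarrow> nat option).
     finite I \<Longrightarrow> (\<And>i. i\<in>I \<Longrightarrow> finite (dom (f i)) \<and> card (dom (f i)) \<le> t * r \<and> ran (f i) \<subseteq> {1..t}) \<Longrightarrow> B < card I
     \<Longrightarrow> (\<exists>J\<subseteq>I. card J = t \<and> (\<forall>i\<in>J. \<forall>j\<in>J. \<forall>v\<in>dom (f i) \<inter> dom (f j). f i v = f j v))"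
    using compatible_maps[where k = "t * r" and t = t and p = t and 'v = nat] by metis
  have "N \<le> B" if rf: "rainbow_free_number r t N" for N
  proof (rule ccontr)
    assume N: "\<not> N \<le> B"
    obtain V :: "nat set" and E M where H: "uniform_hypergraph r V E"
      and M: "\<And>i. i \<in> {1..N} \<Longrightarrow> matching E (M i) \<and> card (M i) = t"
      and nr: "\<not> has_rainbow_matching N M t"
      using rf unfolding rainbow_free_number_def by blast
    have "finite E"
      using H by (auto simp: uniform_hypergraph_def intro: finite_subset[of E "Pow V"])
    have "\<exists>b. bij_betw b {1..t} (M i)" if "i \<in> {1..N}" for i
      using M[OF that] \<open>finite E\<close> ex_bij_betw_nat_finite_1[of "M i"]
      by (auto simp: matching_def dest: finite_subset)
    then obtain b where b: "\<And>i. i \<in> {1..N} \<Longrightarrow> bij_betw (b i) {1..t} (M i)"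
      by metis
    have bM: "b i a \<in> M i" if "i \<in> {1..N}" "a \<in> {1..t}" for i a
      using b[OF that(1)] that(2) by (auto simp: bij_betw_def)
    have bfin: "finite (b i a)" "card (b i a) = r" if "i \<in> {1..N}" "a \<in> {1..t}" for i a
      using bM[OF that] M[OF that(1)] H
      by (auto simp: matching_def uniform_hypergraph_def dest: finite_subset)
    have uniq: "a = a'" if "i \<in> {1..N}" "a \<in> {1..t}" "a' \<in> {1..t}" "v \<in> b i a" "v \<in> b i a'" for i a a' v
    proof -
      have "b i a = b i a'"
        using bM[OF that(1,2)] bM[OF that(1,3)] M[OF that(1)] that(4,5)
        by (auto simp: matching_def disjoint_def)
      then show ?thesis
        using inj_onD[OF bij_betw_imp_inj_on[OF b[OF that(1)]]] that(2,3) by blast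
    qed
    define f where "f = (\<lambda>i v. if \<exists>a\<in>{1..t}. v \<in> b i a then Some (SOME a. a \<in> {1..t} \<and> v \<in> b i a) else None)"
    have f_some: "f i v = Some a" if "i \<in> {1..N}" "a \<in> {1..t}" "v \<in> b i a" for i a v
    proof -
      have "(SOME a. a \<in> {1..t} \<and> v \<in> b i a) = a"
        by (rule some_equality) (use that uniq in blast)+
      then show ?thesis using that by (auto simp: f_def)
    qed
    have "finite (dom (f i)) \<and> card (dom (f i)) \<le> t * r \<and> ran (f i) \<subseteq> {1..t}" if i: "i \<in> {1..N}" for i
    proof -
      have d: "dom (f i) = (\<Union>a\<in>{1..t}. b i a)"
        by (auto simp: f_def split: if_splits; force)
      have "card (\<Union>a\<in>{1..t}. b i a) \<le> (\<Sum>a\<in>{1..t}. card (b i a))"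
        by (rule card_UN_le) simp
      also have "\<dots> = t * r"
        using bfin(2)[OF i] by simp
      finally have "card (dom (f i)) \<le> t * r"
        using d by simp
      moreover have "finite (dom (f i))"
        unfolding d using bfin(1)[OF i] by blast
      moreover have "ran (f i) \<subseteq> {1..t}"
      proof
        fix a assume "a \<in> ran (f i)"
        then obtain v where v: "f i v = Some a"
          by (auto simp: ran_def)
        then obtain a' where "a' \<in> {1..t}" "v \<in> b i a'"
          by (auto simp: f_def split: if_splits)
        with f_some[OF i this] v show "a \<in> {1..t}" by simp
      qed
      ultimately show ?thesis by blast
    qed
    moreover have "B < card {1..N}"
      using N by simp
    ultimately obtain J where J: "J \<subseteq> {1..N}" "card J = t"
      and Jf: "\<And>i j v. i \<in> J \<Longrightarrow> j \<in> J \<Longrightarrow> v \<in> dom (f i) \<inter> dom (f j) \<Longrightarrow> f i v = f j v"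
      using B[of "{1..N}" f] by blast
    have "finite J"
      using J finite_subset by blast
    then obtain h where h: "bij_betw h {1..t} J"
      using ex_bij_betw_nat_finite_1 J by blast
    have hJ: "h k \<in> J" "h k \<in> {1..N}" if "k \<in> {1..t}" for k
      using bij_betwE[OF h] that J(1) by blast+
    have "disjoint_family_on (\<lambda>k. b (h k) k) {1..t}"
      unfolding disjoint_family_on_def
    proof (intro ballI impI, rule ccontr)
      fix k l assume kl: "k \<in> {1..t}" "l \<in> {1..t}" "k \<noteq> l" "b (h k) k \<inter> b (h l) l \<noteq> {}"
      then obtain v where v: "v \<in> b (h k) k" "v \<in> b (h l) l" by blast
      have "f (h k) v = Some k" "f (h l) v = Some l"
        using f_some hJ kl v by auto
      with Jf[of "h k" "h l" v] hJ kl show False by auto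
    qed
    then have "has_rainbow_matching N M t"
      unfolding has_rainbow_matching_def using h J bM hJ
      by (intro exI[of _ h] exI[of _ "\<lambda>k. b (h k) k"]) (auto simp: bij_betw_def)
    with nr show False ..
  qed
  then show ?thesis
    by (meson finite_nat_set_iff_bounded_le mem_Collect_eq)
qed

lemma rainbow_free_number_0: "t \<ge> 1 \<Longrightarrow> rainbow_free_number r t 0"
  unfolding rainbow_free_number_def uniform_hypergraph_def has_rainbow_matching_def
  by (intro exI[of _ "{}"]) auto

lemma F_is_maximum:
  assumes "t \<ge> 1"
  shows "rainbow_free_number r t (F r t)" and "rainbow_free_number r t N \<Longrightarrow> N \<le> F r t"
  using Max_in[OF finite_rainbow_free_numbers, of r t] rainbow_free_number_0[OF assms, of r]
    Max_ge[OF finite_rainbow_free_numbers, of N r t]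
  by (auto simp: F_def)

end

theory Submission
  imports Defs "HOL-Number_Theory.Cong"
begin

text \<open>
  Give the \<open>k\<close>-th edge of every matching a set of private vertices of colour \<open>k\<close>; then
  disjoint edges have distinct colours, and it suffices to find many partitions of a ground set
  into \<open>t\<close> parts of equal size such that no choice of the parts from distinct
  partitions is disjoint. For \<open>t = 2\<close> all complementary pairs work. For \<open>t \<ge> 3\<close> split the ground
  set into zones \<open>z = 3, \<dots>, t\<close> of size \<open>t * s\<close>; in zone \<open>z\<close> the parts 1 and 2 take \<open>s\<close>
  elements each, and part \<open>z\<close> takes the rest. This decouples the zones, and within a zone one
  needs a family of triples \<open>(A, B, C)\<close> in which disjointness of \<open>A\<close>, \<open>B'\<close>, \<open>C''\<close> forces
  \<open>(A, B) = (A', B')\<close>, a uniquely solvable puzzle in the sense of matrix multiplication.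
  As in the Coppersmith-Winograd construction, weigh the elements by random
  residues mod \<open>p\<close>, keep the pairs with \<open>w(A) = w(B) = b\<close> for some \<open>b\<close> in a Behrend set free of
  three-term progressions, and discard the pairs sharing a component with another pair of the same
  class \<open>b\<close>. With \<open>p\<close> about \<open>4 * ((t * s - s) choose s)\<close> at least half of the pairs survive on
  average, so the only loss compared to \<open>(t * s) choose s\<close> is the density of the
  Behrend set, which is exponential in \<open>sqrt s\<close>.
\<close>

section \<open>Progression-free sets of residues (Behrend)\<close>

lemma base_representation_bound:
  fixes x :: "nat \<Rightarrow> int"
  assumes "\<And>c. c < m \<Longrightarrow> 0 \<le> x c \<and> x c < b"
  shows "0 \<le> (\<Sum>c<m. x c * b ^ c) \<and> (\<Sum>c<m. x c * b ^ c) < b ^ m"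
  using assms
proof (induction m)
  case (Suc m)
  have IH: "0 \<le> (\<Sum>c<m. x c * b ^ c)" "(\<Sum>c<m. x c * b ^ c) < b ^ m"
    using Suc by auto
  have xm: "0 \<le> x m" "x m + 1 \<le> b"
    using Suc.prems[of m] by auto
  have bm: "0 \<le> b ^ m"
    using IH by linarith
  have "(x m + 1) * b ^ m \<le> b * b ^ m"
    using xm bm by (intro mult_right_mono)
  moreover have "0 \<le> x m * b ^ m"
    using xm bm by simp
  ultimately show ?case
    using IH by (simp add: algebra_simps)
qed simp

text \<open>The digits below the top one contribute a number in the range from \<open>0\<close> to
  \<open>b ^ m - 1\<close>, so division by \<open>b ^ m\<close> isolates the top digit; induction
  recovers the others.\<close>

lemma base_representation_unique:
  fixes x y :: "nat \<Rightarrow> int"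
  assumes "\<And>c. c < m \<Longrightarrow> 0 \<le> x c \<and> x c < b" "\<And>c. c < m \<Longrightarrow> 0 \<le> y c \<and> y c < b"
    and "(\<Sum>c<m. x c * b ^ c) = (\<Sum>c<m. y c * b ^ c)" "c < m"
  shows "x c = y c"
  using assms
proof (induction m arbitrary: c)
  case (Suc m)
  let ?X = "\<Sum>c<m. x c * b ^ c" and ?Y = "\<Sum>c<m. y c * b ^ c"
  have X: "0 \<le> ?X" "?X < b ^ m" and Y: "0 \<le> ?Y" "?Y < b ^ m"
    using base_representation_bound[of m x b] base_representation_bound[of m y b] Suc.prems by auto
  have eq: "?X + x m * b ^ m = ?Y + y m * b ^ m"
    using Suc.prems(3) by simp
  have "b ^ m \<noteq> 0"
    using X by linarith
  then have "(?X + x m * b ^ m) div b ^ m = x m" "(?Y + y m * b ^ m) div b ^ m = y m"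
    using div_mult_self1[of "b ^ m" ?X "x m"] div_mult_self1[of "b ^ m" ?Y "y m"]
      div_pos_pos_trivial[OF X] div_pos_pos_trivial[OF Y] by linarith+
  then have top: "x m = y m"
    using eq by metis
  with eq have "?X = ?Y" by simp
  then have "x c = y c" if "c < m" for c
    using Suc.IH[OF _ _ _ that] Suc.prems by auto
  with top Suc.prems(4) show ?case
    by (cases "c = m") auto
qed simp

text \<open>
  Digit vectors on a sphere, read in base \<open>2 * h\<close>: with digits below \<open>h\<close> neither sum in
  \<open>x + y = 2 * z\<close> produces carries or wraps around, and a sphere contains no midpoint of two of
  its points.
\<close>

lemma behrend_set:
  fixes h m :: nat
  assumes h: "h > 0"
  shows "\<exists>S \<subseteq> {0..<int ((2 * h) ^ m)}. h ^ m \<le> card S * (m * h\<^sup>2 + 1) \<and>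
    (\<forall>x\<in>S. \<forall>y\<in>S. \<forall>z\<in>S. [x + y = 2 * z] (mod int ((2 * h) ^ m)) \<longrightarrow> x = y)"
proof -
  define b where "b = 2 * int h"
  define D where "D = (\<Pi>\<^sub>E c\<in>{..<m}. {0..<int h})"
  define q where "q = (\<lambda>x :: nat \<Rightarrow> int. nat (\<Sum>c<m. (x c)\<^sup>2))"
  define val where "val = (\<lambda>x :: nat \<Rightarrow> int. \<Sum>c<m. x c * b ^ c)"
  have cD: "card D = h ^ m" and finD: "finite D"
    by (auto simp: D_def card_PiE finite_PiE)
  have dig: "0 \<le> x c \<and> x c < int h" if "x \<in> D" "c < m" for x c
    using that by (auto simp: D_def PiE_iff)
  have q_le: "q x \<in> {..m * h\<^sup>2}" if "x \<in> D" for x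
  proof -
    have "(\<Sum>c<m. (x c)\<^sup>2) \<le> (\<Sum>c<m. (int h)\<^sup>2)"
      using dig[OF that] by (intro sum_mono power_mono) (auto intro: less_imp_le)
    also have "\<dots> = int (m * h\<^sup>2)" by simp
    finally show ?thesis
      unfolding q_def atMost_iff by linarith
  qed
  \<comment> \<open>Pigeonhole: the squared norm takes at most \<open>m * h\<^sup>2 + 1\<close>
    values, so some sphere holds at least the average number of digit vectors.\<close>
  have "\<exists>r. h ^ m \<le> card {x \<in> D. q x = r} * (m * h\<^sup>2 + 1)"
  proof (rule ccontr)
    assume "\<not> ?thesis"
    then have lt: "card {x \<in> D. q x = r} * (m * h\<^sup>2 + 1) < h ^ m" for r
      by (meson not_le)
    have "h ^ m = card (\<Union>r\<in>{..m * h\<^sup>2}. {x \<in> D. q x = r})"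
      unfolding cD[symmetric] using q_le by (intro arg_cong[where f = card]) auto
    also have "\<dots> \<le> (\<Sum>r\<in>{..m * h\<^sup>2}. card {x \<in> D. q x = r})"
      by (rule card_UN_le) simp
    finally have "h ^ m * (m * h\<^sup>2 + 1) \<le> (\<Sum>r\<in>{..m * h\<^sup>2}. card {x \<in> D. q x = r}) * (m * h\<^sup>2 + 1)"
      by (rule mult_right_mono) simp
    also have "\<dots> = (\<Sum>r\<in>{..m * h\<^sup>2}. card {x \<in> D. q x = r} * (m * h\<^sup>2 + 1))"
      by (rule sum_distrib_right)
    also have "\<dots> < (\<Sum>r\<in>{..m * h\<^sup>2}. h ^ m)"
      using lt by (intro sum_strict_mono) auto
    finally show False by (simp add: mult.commute)
  qed
  then obtain r where r: "h ^ m \<le> card {x \<in> D. q x = r} * (m * h\<^sup>2 + 1)" ..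
  let ?R = "{x \<in> D. q x = r}"
  have dig2: "0 \<le> x c \<and> x c < b" if "x \<in> D" "c < m" for x c
    using dig[OF that] h by (auto simp: b_def)
  have inj: "inj_on val D"
  proof (rule inj_onI)
    fix x y assume xy: "x \<in> D" "y \<in> D" "val x = val y"
    have "x c = y c" if "c < m" for c
      using base_representation_unique[of m x b y c] dig2 xy that by (auto simp: val_def)
    then show "x = y"
      using xy(1,2) by (intro PiE_ext[of x "{..<m}" "\<lambda>_. {0..<int h}" y]) (auto simp: D_def)
  qed
  have bm: "b ^ m = int ((2 * h) ^ m)" by (simp add: b_def)
  show ?thesis
  proof (intro exI[of _ "val ` ?R"] conjI ballI impI)
    show "val ` ?R \<subseteq> {0..<int ((2 * h) ^ m)}"
      using base_representation_bound[of m _ b] dig2 unfolding bm[symmetric] val_def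
      by (auto simp: image_subset_iff)
    have "card (val ` ?R) = card ?R"
      by (rule card_image) (rule inj_on_subset[OF inj], auto)
    with r show "h ^ m \<le> card (val ` ?R) * (m * h\<^sup>2 + 1)" by simp
  next
    fix vx vy vz
    assume "vx \<in> val ` ?R" "vy \<in> val ` ?R" "vz \<in> val ` ?R"
    then obtain x y z where xyz: "x \<in> D" "y \<in> D" "z \<in> D" "q x = r" "q y = r" "q z = r"
      and v: "vx = val x" "vy = val y" "vz = val z"
      by auto
    assume cong: "[vx + vy = 2 * vz] (mod int ((2 * h) ^ m))"
    have 1: "vx + vy = (\<Sum>c<m. (x c + y c) * b ^ c)" "2 * vz = (\<Sum>c<m. (2 * z c) * b ^ c)"
      by (simp_all add: v val_def sum.distrib sum_distrib_left algebra_simps)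
    have dx: "0 \<le> x c + y c \<and> x c + y c < b" "0 \<le> 2 * z c \<and> 2 * z c < b" if "c < m" for c
      using dig[OF xyz(1) that] dig[OF xyz(2) that] dig[OF xyz(3) that] by (auto simp: b_def)
    have "vx + vy = 2 * vz"
    proof -
      have "0 \<le> vx + vy" "vx + vy < b ^ m" "0 \<le> 2 * vz" "2 * vz < b ^ m"
        using base_representation_bound[of m "\<lambda>c. x c + y c" b] base_representation_bound[of m "\<lambda>c. 2 * z c" b] dx
        unfolding 1 by auto
      with cong show ?thesis
        unfolding bm[symmetric] by (intro cong_less_imp_eq_int[of _ "b ^ m"]) auto
    qed
    then have mid: "x c + y c = 2 * z c" if "c < m" for c
      using base_representation_unique[of m "\<lambda>c. x c + y c" b "\<lambda>c. 2 * z c" c] dx that unfolding 1 by auto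
    have sq: "(\<Sum>c<m. (f c)\<^sup>2) = int r" if "q f = r" for f
      using that sum_nonneg[of "{..<m}" "\<lambda>c. (f c)\<^sup>2"] by (simp add: q_def)
    \<comment> \<open>Parallelogram law for a midpoint \<open>z\<close>: as the three squared norms
      all equal \<open>r\<close>, the distance of \<open>x\<close> and \<open>y\<close>
      vanishes.\<close>
    have "(\<Sum>c<m. (x c - y c)\<^sup>2) = (\<Sum>c<m. 2 * (x c)\<^sup>2 + 2 * (y c)\<^sup>2 - 4 * (z c)\<^sup>2)"
    proof (rule sum.cong)
      fix c assume "c \<in> {..<m}"
      then have "(x c + y c)\<^sup>2 = (2 * z c)\<^sup>2" using mid[of c] by simp
      then show "(x c - y c)\<^sup>2 = 2 * (x c)\<^sup>2 + 2 * (y c)\<^sup>2 - 4 * (z c)\<^sup>2"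
        by (simp add: power2_eq_square algebra_simps)
    qed simp
    also have "\<dots> = 2 * (\<Sum>c<m. (x c)\<^sup>2) + 2 * (\<Sum>c<m. (y c)\<^sup>2) - 4 * (\<Sum>c<m. (z c)\<^sup>2)"
      by (simp add: sum.distrib sum_subtractf sum_distrib_left)
    also have "\<dots> = 0" using sq xyz by simp
    finally have "\<forall>c\<in>{..<m}. (x c - y c)\<^sup>2 = 0"
      by (subst (asm) sum_nonneg_eq_0_iff) auto
    then show "vx = vy" by (simp add: v val_def)
  qed
qed

section \<open>Random weights and uniquely solvable families\<close>

text \<open>Shifting the weight of \<open>u\<close> modulo \<open>p\<close> permutes the weightings,
  preserves \<open>\<Psi>\<close> and moves the residue of the sum over \<open>A\<close> by any
  prescribed amount. So all residues are equally frequent: in counting form, the residue is uniform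
  and independent of \<open>\<Psi>\<close>.\<close>

lemma card_weights_linear_condition:
  fixes p :: nat and X :: "'a set"
  defines "W \<equiv> (\<Pi>\<^sub>E v\<in>X. {0..<int p})"
  assumes p: "p > 0" and X: "finite X" and u: "u \<in> A" "A \<subseteq> X"
    and \<Psi>: "\<And>w c. \<Psi> (w(u := c)) \<longleftrightarrow> \<Psi> w" and b: "b \<in> {0..<int p}"
  shows "p * card {w \<in> W. \<Psi> w \<and> (\<Sum>v\<in>A. w v) mod int p = b} = card {w \<in> W. \<Psi> w}"
proof -
  define S where "S = (\<lambda>c. {w \<in> W. \<Psi> w \<and> (\<Sum>v\<in>A. w v) mod int p = c})"
  have finW: "finite W" unfolding W_def using X by (intro finite_PiE) auto
  have finA: "finite A" using X u finite_subset by blast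
  define sh where "sh = (\<lambda>(d :: int) (w :: 'a \<Rightarrow> int). w(u := (w u + d) mod int p))"
  have sh_W: "sh d w \<in> W" if "w \<in> W" for d w
    using that p u unfolding W_def sh_def by (intro PiE_I) (auto simp: PiE_iff extensional_def)
  have sh_sh: "sh (- d) (sh d w) = w" if "w \<in> W" for d w
  proof -
    have "w u \<in> {0..<int p}" using that u unfolding W_def by (auto simp: PiE_iff)
    then have "((w u + d) mod int p - d) mod int p = w u"
      by (simp add: mod_diff_left_eq)
    then show ?thesis by (auto simp: sh_def)
  qed
  have sh_sum: "(\<Sum>v\<in>A. sh d w v) mod int p = ((\<Sum>v\<in>A. w v) + d) mod int p" for d w
  proof -
    have "(\<Sum>v\<in>A. sh d w v) = (w u + d) mod int p + (\<Sum>v\<in>A - {u}. w v)"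
      using finA u by (subst sum.remove[of A u]) (auto simp: sh_def)
    moreover have "(\<Sum>v\<in>A. w v) = w u + (\<Sum>v\<in>A - {u}. w v)"
      using finA u by (subst sum.remove[of A u]) auto
    ultimately show ?thesis
      using mod_add_left_eq[of "w u + d" "int p" "\<Sum>v\<in>A - {u}. w v"] by (simp add: ac_simps)
  qed
  have "card (S c) = card (S b)" if c: "c \<in> {0..<int p}" for c
  proof (rule bij_betw_same_card[of "sh (b - c)"], rule bij_betw_byWitness[where f' = "sh (c - b)"])
    show "\<forall>w\<in>S c. sh (c - b) (sh (b - c) w) = w"
      using sh_sh[of _ "b - c"] by (auto simp: S_def)
    show "\<forall>w\<in>S b. sh (b - c) (sh (c - b) w) = w"
      using sh_sh[of _ "c - b"] by (auto simp: S_def)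
    have mv: "sh (e - d) w \<in> S e" if "w \<in> S d" "e \<in> {0..<int p}" for w d e
    proof -
      have "((\<Sum>v\<in>A. w v) + (e - d)) mod int p = e"
        using that mod_add_left_eq[of "\<Sum>v\<in>A. w v" "int p" "e - d"] by (auto simp: S_def)
      moreover have "\<Psi> (sh (e - d) w)"
        using that \<Psi> by (auto simp: S_def sh_def)
      ultimately show ?thesis
        using that sh_W sh_sum by (auto simp: S_def)
    qed
    show "sh (b - c) ` S c \<subseteq> S b" "sh (c - b) ` S b \<subseteq> S c"
      using mv b c by auto
  qed
  then have "(\<Sum>c\<in>{0..<int p}. card (S c)) = p * card (S b)" by simp
  moreover have "card (\<Union>c\<in>{0..<int p}. S c) = (\<Sum>c\<in>{0..<int p}. card (S c))"
    by (rule card_UN_disjoint) (auto simp: S_def finW)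
  moreover have "(\<Union>c\<in>{0..<int p}. S c) = {w \<in> W. \<Psi> w}"
    using p by (auto simp: S_def)
  ultimately show ?thesis by (simp add: S_def)
qed

lemma card_disjoint_pairs:
  assumes "finite X"
  shows "card (SIGMA A:{A. A \<subseteq> X \<and> card A = s}. {B. B \<subseteq> X - A \<and> card B = s})
    = (card X choose s) * ((card X - s) choose s)"
proof -
  have "card {B. B \<subseteq> X - A \<and> card B = s} = (card X - s) choose s" if "A \<subseteq> X" "card A = s" for A
  proof -
    have "card (X - A) = card X - s"
      using that assms by (metis card_Diff_subset finite_subset)
    then show ?thesis
      using n_subsets[of "X - A" s] assms by simp
  qed
  then show ?thesis
    using assms by (subst card_SigmaI) (auto simp: n_subsets)
qed

text \<open>The third member of a triple is the complement of \<open>A'' \<union> B''\<close>; by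
  cardinality, disjointness of the three sets amounts to the stated equation of unions. Summing
  weights turns that equation into \<open>x + y = 2 * z\<close> for the class labels, so
  \<open>x = y\<close>, and isolation within the class finishes. For the size, a pair lies in a
  given class for a fraction \<open>1 / p\<^sup>2\<close> of the weightings, and at most half of
  this is lost to collisions.\<close>

lemma uniquely_solvable_family:
  fixes X :: "'a set" and p s :: nat and S :: "int set"
  assumes X: "finite X" and s: "s > 0" and p: "p > 0" "4 * ((card X - s) choose s) \<le> p"
    and S: "S \<subseteq> {0..<int p}"
    and free: "\<forall>x\<in>S. \<forall>y\<in>S. \<forall>z\<in>S. [x + y = 2 * z] (mod int p) \<longrightarrow> x = y"
  shows "\<exists>U \<subseteq> {(A, B). A \<subseteq> X \<and> B \<subseteq> X \<and> card A = s \<and> card B = s \<and> A \<inter> B = {}}.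
    card S * ((card X choose s) * ((card X - s) choose s)) \<le> card U * (2 * p\<^sup>2) \<and>
    (\<forall>(A, B)\<in>U. \<forall>(A', B')\<in>U. \<forall>(A'', B'')\<in>U.
       A \<inter> B' = {} \<longrightarrow> A \<union> B' = A'' \<union> B'' \<longrightarrow> A = A' \<and> B = B')"
proof -
  define W where "W = (\<Pi>\<^sub>E v\<in>X. {0..<int p})"
  define \<sigma> where "\<sigma> = (\<lambda>(w :: 'a \<Rightarrow> int) A. (\<Sum>v\<in>A. w v) mod int p)"
  define T where "T = (SIGMA A:{A. A \<subseteq> X \<and> card A = s}. {B. B \<subseteq> X - A \<and> card B = s})"
  \<comment> \<open>One set serves for both kinds of collision: \<open>T\<close> is symmetric, so a
    shared second component becomes a shared first one after swapping.\<close>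
  define T3 where "T3 = {(A, B, B'). (A, B) \<in> T \<and> (A, B') \<in> T \<and> B \<noteq> B'}"
  define G where "G = (\<lambda>w b. {(A, B) \<in> T. \<sigma> w A = b \<and> \<sigma> w B = b})"
  define R where "R = (\<lambda>w b. {(A, B, B') \<in> T3. \<sigma> w A = b \<and> \<sigma> w B = b \<and> \<sigma> w B' = b})"
  define good where "good = (\<lambda>w b. {(A, B) \<in> G w b.
    (\<forall>B'. (A, B') \<in> G w b \<longrightarrow> B' = B) \<and> (\<forall>A'. (A', B) \<in> G w b \<longrightarrow> A' = A)})"
  let ?D = "(card X - s) choose s"
  have finW: "finite W" unfolding W_def using X by (intro finite_PiE) auto
  have W0: "card W > 0"
    using p X by (auto simp: W_def card_PiE)
  have T_eq: "T = {(A, B). A \<subseteq> X \<and> B \<subseteq> X \<and> card A = s \<and> card B = s \<and> A \<inter> B = {}}"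
    unfolding T_def by blast
  have finT: "finite T"
    unfolding T_eq by (rule finite_subset[of _ "Pow X \<times> Pow X"]) (use X in auto)
  have cardT: "card T = (card X choose s) * ?D"
    unfolding T_def using X by (rule card_disjoint_pairs)
  \<comment> \<open>Dropping the condition \<open>B \<noteq> B'\<close> leaves exactly
    \<open>?D\<close> choices of \<open>B'\<close> for every pair in \<open>T\<close>.\<close>
  define T3' where "T3' = (\<Union>P\<in>T. (\<lambda>B'. (fst P, snd P, B')) ` {B'. B' \<subseteq> X - fst P \<and> card B' = s})"
  have sub3: "T3 \<subseteq> T3'"
    unfolding T3_def T3'_def T_eq by (force simp: image_iff)
  have fin3: "finite T3'"
    unfolding T3'_def using finT X by auto
  have "card T3' \<le> card T * ?D"
  proof -
    have "card T3' \<le> (\<Sum>P\<in>T. card ((\<lambda>B'. (fst P, snd P, B')) ` {B'. B' \<subseteq> X - fst P \<and> card B' = s}))"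
      unfolding T3'_def by (rule card_UN_le[OF finT])
    also have "\<dots> \<le> (\<Sum>P\<in>T. ?D)"
    proof (rule sum_mono)
      fix P assume "P \<in> T"
      then have "card (X - fst P) = card X - s"
        using X by (auto simp: T_eq card_Diff_subset finite_subset)
      then have cD: "card {B'. B' \<subseteq> X - fst P \<and> card B' = s} = ?D"
        using n_subsets[of "X - fst P" s] X by simp
      have "finite {B'. B' \<subseteq> X - fst P \<and> card B' = s}"
        using X by simp
      from card_image_le[OF this] cD show "card ((\<lambda>B'. (fst P, snd P, B')) ` {B'. B' \<subseteq> X - fst P \<and> card B' = s}) \<le> ?D"
        by metis
    qed
    finally show ?thesis by simp
  qed
  then have cardT3: "card T3 \<le> card T * ?D"
    using card_mono[OF fin3 sub3] by linarith
  have finT3: "finite T3"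
    using sub3 fin3 by (rule finite_subset)
  have ne: "\<exists>v. v \<in> A" if "card A = s" for A :: "'a set"
    using that s by (metis card.empty ex_in_conv less_irrefl)
  have \<sigma>_upd: "\<sigma> (w(u := c)) A = \<sigma> w A" if "u \<notin> A" for w u c A
  proof -
    have "(\<Sum>v\<in>A. (w(u := c)) v) = (\<Sum>v\<in>A. w v)"
      using that by (intro sum.cong) auto
    then show ?thesis by (simp add: \<sigma>_def)
  qed
  have step: "p * card {w \<in> W. \<Psi> w \<and> \<sigma> w A = b} = card {w \<in> W. \<Psi> w}"
    if "u \<in> A" "A \<subseteq> X" "\<And>w c. \<Psi> (w(u := c)) \<longleftrightarrow> \<Psi> w" "b \<in> S" for u A \<Psi> b
    unfolding W_def \<sigma>_def
    by (rule card_weights_linear_condition[OF p(1) X that(1,2)]) (use that S in auto)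
  have G_count: "p\<^sup>2 * card {w \<in> W. \<sigma> w A = b \<and> \<sigma> w B = b} = card W" if "(A, B) \<in> T" "b \<in> S" for A B b
  proof -
    have AB: "A \<subseteq> X" "B \<subseteq> X" "card A = s" "card B = s" "A \<inter> B = {}"
      using that by (auto simp: T_eq)
    obtain a c where ac: "a \<in> A" "c \<in> B" using ne AB by blast
    have "c \<notin> A" using ac AB by blast
    then have "p * card {w \<in> W. \<sigma> w A = b \<and> \<sigma> w B = b} = card {w \<in> W. \<sigma> w A = b}"
      using ac AB that by (intro step[of c]) (auto simp: \<sigma>_upd)
    moreover have "p * card {w \<in> W. True \<and> \<sigma> w A = b} = card {w \<in> W. True}"
      using ac AB that by (intro step[of a]) auto
    ultimately show ?thesis by (simp add: power2_eq_square mult.assoc)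
  qed
  \<comment> \<open>An element of \<open>B' - B\<close> lies in neither \<open>A\<close> nor \<open>B\<close>, so the third condition is independent of
    the other two.\<close>
  have R_count: "p ^ 3 * card {w \<in> W. \<sigma> w A = b \<and> \<sigma> w B = b \<and> \<sigma> w B' = b} = card W"
    if T3: "(A, B, B') \<in> T3" and b: "b \<in> S" for A B B' b
  proof -
    have AB: "(A, B) \<in> T" "A \<subseteq> X" "B \<subseteq> X" "B' \<subseteq> X" "card A = s" "card B = s" "card B' = s"
        "A \<inter> B = {}" "A \<inter> B' = {}" "B \<noteq> B'"
      using T3 by (auto simp: T3_def T_eq)
    have "finite B" using AB X finite_subset by blast
    then have "\<not> B' \<subseteq> B"
      using AB by (metis card_subset_eq)
    then obtain v where v: "v \<in> B'" "v \<notin> B" by blast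
    have "v \<notin> A" using v AB by blast
    with v have "p * card {w \<in> W. (\<sigma> w A = b \<and> \<sigma> w B = b) \<and> \<sigma> w B' = b}
        = card {w \<in> W. \<sigma> w A = b \<and> \<sigma> w B = b}"
      using AB b by (intro step[of v]) (auto simp: \<sigma>_upd)
    with G_count[OF AB(1) b] show ?thesis
      by (simp add: power3_eq_cube power2_eq_square mult.assoc)
  qed
  have good_G: "good w b \<subseteq> G w b" for w b
    unfolding good_def by blast
  have fin: "finite (G w b)" "finite (R w b)" "finite (good w b)" for w b
    using finT finT3 by (auto simp: G_def R_def good_def intro: rev_finite_subset[OF finT] rev_finite_subset[OF finT3])
  have G_sum: "p\<^sup>2 * (\<Sum>w\<in>W. card (G w b)) = card T * card W" if "b \<in> S" for b
  proof -
    have "(\<Sum>w\<in>W. card {P \<in> T. \<sigma> w (fst P) = b \<and> \<sigma> w (snd P) = b})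
        = (\<Sum>P\<in>T. card {w \<in> W. \<sigma> w (fst P) = b \<and> \<sigma> w (snd P) = b})"
      by (rule sum_multicount_gen[OF finW finT]) simp
    moreover have "G w b = {P \<in> T. \<sigma> w (fst P) = b \<and> \<sigma> w (snd P) = b}" for w
      by (auto simp: G_def)
    ultimately have "p\<^sup>2 * (\<Sum>w\<in>W. card (G w b))
        = (\<Sum>P\<in>T. p\<^sup>2 * card {w \<in> W. \<sigma> w (fst P) = b \<and> \<sigma> w (snd P) = b})"
      by (simp add: sum_distrib_left)
    also have "\<dots> = (\<Sum>P\<in>T. card W)"
      using G_count that by (intro sum.cong) auto
    finally show ?thesis by simp
  qed
  have R_sum: "p ^ 3 * (\<Sum>w\<in>W. card (R w b)) = card T3 * card W" if "b \<in> S" for b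
  proof -
    let ?Q = "\<lambda>w P. \<sigma> w (fst P) = b \<and> \<sigma> w (fst (snd P)) = b \<and> \<sigma> w (snd (snd P)) = b"
    have "(\<Sum>w\<in>W. card {P \<in> T3. ?Q w P}) = (\<Sum>P\<in>T3. card {w \<in> W. ?Q w P})"
      by (rule sum_multicount_gen[OF finW finT3]) simp
    moreover have "R w b = {P \<in> T3. ?Q w P}" for w
      by (auto simp: R_def)
    ultimately have "p ^ 3 * (\<Sum>w\<in>W. card (R w b)) = (\<Sum>P\<in>T3. p ^ 3 * card {w \<in> W. ?Q w P})"
      by (simp add: sum_distrib_left)
    also have "\<dots> = (\<Sum>P\<in>T3. card W)"
      using R_count that by (intro sum.cong) auto
    finally show ?thesis by simp
  qed
  \<comment> \<open>Every discarded pair is charged to a collision: by projection if it shares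
    \<open>A\<close>, by projection and swap if it shares \<open>B\<close>. Hence the factor
    2.\<close>
  have G_le: "card (G w b) \<le> card (good w b) + 2 * card (R w b)" for w b
  proof -
    let ?f = "\<lambda>(C, D, D' :: 'a set). (C :: 'a set, D :: 'a set)"
    let ?g = "\<lambda>(C, D, D' :: 'a set). (D :: 'a set, C :: 'a set)"
    have "G w b \<subseteq> good w b \<union> ?f ` R w b \<union> ?g ` R w b"
    proof (rule subsetI, rule ccontr)
      fix P assume P: "P \<in> G w b" and notin: "P \<notin> good w b \<union> ?f ` R w b \<union> ?g ` R w b"
      obtain A B where P_eq: "P = (A, B)" by fastforce
      have AB: "(A, B) \<in> G w b" and g: "(A, B) \<notin> ?g ` R w b" and f: "(A, B) \<notin> ?f ` R w b"
        using P notin by (auto simp only: P_eq Un_iff)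
      have "B' = B" if "(A, B') \<in> G w b" for B'
      proof (rule ccontr)
        assume "B' \<noteq> B"
        then have "(A, B, B') \<in> R w b" using that AB by (auto simp: R_def T3_def G_def)
        with f show False by (force simp: image_iff)
      qed
      moreover have "A' = A" if "(A', B) \<in> G w b" for A'
      proof (rule ccontr)
        assume "A' \<noteq> A"
        then have "(B, A, A') \<in> R w b" using that AB by (auto simp: R_def T3_def G_def T_eq)
        with g show False by (force simp: image_iff)
      qed
      ultimately have "(A, B) \<in> good w b"
        unfolding good_def mem_Collect_eq prod.case using AB by blast
      with notin P_eq show False by blast
    qed
    then have "card (G w b) \<le> card (good w b \<union> ?f ` R w b \<union> ?g ` R w b)"
      using fin by (intro card_mono) auto
    also have "\<dots> \<le> card (good w b) + card (?f ` R w b) + card (?g ` R w b)"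
      using card_Un_le[of "good w b \<union> ?f ` R w b" "?g ` R w b"] card_Un_le[of "good w b" "?f ` R w b"]
      by linarith
    also have "\<dots> \<le> card (good w b) + card (R w b) + card (R w b)"
      using fin by (intro add_mono card_image_le) auto
    finally show ?thesis by simp
  qed
  \<comment> \<open>Since \<open>4 * ?D \<le> p\<close>, the collisions number on average at most a
    quarter of the pairs of class \<open>b\<close>; deleting two pairs per collision leaves at least
    half.\<close>
  have good_sum: "card T * card W \<le> 2 * p\<^sup>2 * (\<Sum>w\<in>W. card (good w b))" if b: "b \<in> S" for b
  proof -
    let ?G = "\<Sum>w\<in>W. card (G w b)" and ?R = "\<Sum>w\<in>W. card (R w b)" and ?g = "\<Sum>w\<in>W. card (good w b)"
    have "p * (4 * p\<^sup>2 * ?R) = 4 * card T3 * card W"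
      using R_sum[OF b] by (simp add: power3_eq_cube power2_eq_square mult.assoc)
    also have "\<dots> \<le> 4 * (card T * ?D) * card W"
      using cardT3 by (intro mult_mono) auto
    also have "\<dots> = (4 * ?D) * (card T * card W)"
      by simp
    also have "\<dots> \<le> p * (card T * card W)"
      using p by (intro mult_right_mono) auto
    finally have R4: "4 * p\<^sup>2 * ?R \<le> card T * card W"
      using p(1) by simp
    have "?G \<le> (\<Sum>w\<in>W. card (good w b) + 2 * card (R w b))"
      by (intro sum_mono G_le)
    also have "\<dots> = ?g + 2 * ?R"
      by (simp add: sum.distrib sum_distrib_left)
    finally have "2 * p\<^sup>2 * ?G \<le> 2 * p\<^sup>2 * (?g + 2 * ?R)"
      by (rule mult_left_mono) simp
    also have "\<dots> = 2 * p\<^sup>2 * ?g + 4 * p\<^sup>2 * ?R"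
      by (simp add: algebra_simps)
    finally have "2 * (card T * card W) \<le> 2 * p\<^sup>2 * ?g + 4 * p\<^sup>2 * ?R"
      using G_sum[OF b] by simp
    with R4 show ?thesis by linarith
  qed
  \<comment> \<open>Averaging over \<open>W\<close> gives one weighting that is good for all classes
    in \<open>S\<close> taken together.\<close>
  have "\<exists>w\<in>W. card S * card T \<le> 2 * p\<^sup>2 * (\<Sum>b\<in>S. card (good w b))"
  proof (rule ccontr)
    assume "\<not> ?thesis"
    then have lt: "\<And>w. w \<in> W \<Longrightarrow> 2 * p\<^sup>2 * (\<Sum>b\<in>S. card (good w b)) < card S * card T"
      by (meson not_le)
    have "card S * (card T * card W) \<le> (\<Sum>b\<in>S. 2 * p\<^sup>2 * (\<Sum>w\<in>W. card (good w b)))"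
      using sum_mono[of S "\<lambda>_. card T * card W", OF good_sum] by simp
    also have "\<dots> = (\<Sum>w\<in>W. 2 * p\<^sup>2 * (\<Sum>b\<in>S. card (good w b)))"
      by (simp only: sum_distrib_left) (rule sum.swap)
    also have "\<dots> < (\<Sum>w\<in>W. card S * card T)"
      using lt W0 finW by (intro sum_strict_mono) auto
    finally show False by simp
  qed
  then obtain w where w: "card S * card T \<le> 2 * p\<^sup>2 * (\<Sum>b\<in>S. card (good w b))" ..
  define U where "U = (\<Union>b\<in>S. good w b)"
  have finS: "finite S" using S finite_subset by blast
  \<comment> \<open>The classes are disjoint because the label \<open>b\<close> is the residue of
    the first component.\<close>
  have "card U = (\<Sum>b\<in>S. card (good w b))"
    unfolding U_def using fin finS by (intro card_UN_disjoint) (auto simp: good_def G_def)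
  with w have U_card: "card S * card T \<le> card U * (2 * p\<^sup>2)" by (simp add: mult.commute)
  have "A = A' \<and> B = B'"
    if U: "(A, B) \<in> U" "(A', B') \<in> U" "(A'', B'') \<in> U" and disj: "A \<inter> B' = {}" and un: "A \<union> B' = A'' \<union> B''"
    for A B A' B' A'' B''
  proof -
    obtain x y z where xyz: "x \<in> S" "y \<in> S" "z \<in> S"
      and g: "(A, B) \<in> good w x" "(A', B') \<in> good w y" "(A'', B'') \<in> good w z"
      using U by (auto simp: U_def)
    have gG: "(A, B) \<in> G w x" "(A', B') \<in> G w y" "(A'', B'') \<in> G w z"
      using g good_G by blast+
    then have \<sigma>: "\<sigma> w A = x" "\<sigma> w B' = y" "\<sigma> w A'' = z" "\<sigma> w B'' = z"
      by (auto simp: G_def)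
    have sub: "A \<subseteq> X" "B' \<subseteq> X" "A'' \<subseteq> X" "B'' \<subseteq> X" "A'' \<inter> B'' = {}" "card A = s" "card B' = s"
      using gG by (auto simp: G_def T_eq)
    then have finite: "finite A" "finite B'" "finite A''" "finite B''"
      using X finite_subset by auto
    have "sum w A + sum w B' = sum w A'' + sum w B''"
      using un disj sub finite by (metis sum.union_disjoint)
    moreover have "[x + y = sum w A + sum w B'] (mod int p)"
      using \<sigma> by (intro cong_add) (auto simp: \<sigma>_def cong_def)
    moreover have "[sum w A'' + sum w B'' = z + z] (mod int p)"
      using \<sigma> by (intro cong_add) (auto simp: \<sigma>_def cong_def)
    ultimately have "[x + y = 2 * z] (mod int p)"
      unfolding mult_2 by (metis cong_trans)
    then have "x = y" using free xyz by blast
    \<comment> \<open>The mixed pair lies in the common class. It shares \<open>A\<close> with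
      \<open>(A, B)\<close> and \<open>B'\<close> with \<open>(A', B')\<close>, so goodness of these
      two yields \<open>B' = B\<close> and \<open>A = A'\<close>.\<close>
    then have "(A, B') \<in> G w x"
      using \<sigma> sub disj by (auto simp: G_def T_eq)
    then show ?thesis
      using g(1,2) unfolding \<open>x = y\<close> good_def mem_Collect_eq prod.case by metis
  qed
  then have "\<forall>(A, B)\<in>U. \<forall>(A', B')\<in>U. \<forall>(A'', B'')\<in>U.
       A \<inter> B' = {} \<longrightarrow> A \<union> B' = A'' \<union> B'' \<longrightarrow> A = A' \<and> B = B'"
    by blast
  moreover have "U \<subseteq> T"
    using good_G by (auto simp: U_def G_def)
  ultimately show ?thesis
    using U_card[unfolded cardT] unfolding T_eq by (intro exI[of _ U] conjI)
qed

section \<open>From partitions to matchings without a rainbow matching\<close>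

text \<open>All \<open>k\<close>-th edges contain the same \<open>d\<close> private vertices, so two
  edges of equal colour always meet. A rainbow matching of size \<open>t\<close> therefore uses each
  colour exactly once, and listing its edges by colour produces a choice \<open>j\<close> that
  \<open>free\<close> excludes.\<close>

lemma rainbow_free_number_pieces:
  fixes P :: "'i \<Rightarrow> nat \<Rightarrow> 'a set"
  assumes I: "finite I" and X: "finite X" and d: "d > 0"
    and piece: "\<And>i k. i \<in> I \<Longrightarrow> k \<in> {1..t} \<Longrightarrow> P i k \<subseteq> X \<and> card (P i k) = s"
    and disj: "\<And>i. i \<in> I \<Longrightarrow> disjoint_family_on (P i) {1..t}"
    and free: "\<And>j. j ` {1..t} \<subseteq> I \<Longrightarrow> inj_on j {1..t} \<Longrightarrow> \<not> disjoint_family_on (\<lambda>k. P (j k) k) {1..t}"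
  shows "rainbow_free_number (s + d) t (card I)"
proof -
  define V where "V = X <+> ({1..t} \<times> {..<d})"
  define edge where "edge = (\<lambda>i k. P i k <+> ({k} \<times> {..<d}))"
  have finV: "finite V" unfolding V_def using X by simp
  \<comment> \<open>\<open>rainbow_free_number\<close> asks for natural numbers as vertices, so the
    finite set \<open>V\<close> is relabelled.\<close>
  then obtain f :: "_ \<Rightarrow> nat" where f: "inj_on f V"
    using finite_imp_inj_to_nat_seg by blast
  define ed where "ed = (\<lambda>i k. f ` edge i k)"
  have edge_V: "edge i k \<subseteq> V" if "i \<in> I" "k \<in> {1..t}" for i k
    using piece[OF that] that(2) by (auto simp: edge_def V_def)
  have ed_Int: "ed i k \<inter> ed i' k' = {} \<longleftrightarrow> k \<noteq> k' \<and> P i k \<inter> P i' k' = {}"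
    if "i \<in> I" "k \<in> {1..t}" "i' \<in> I" "k' \<in> {1..t}" for i k i' k'
  proof -
    have "ed i k \<inter> ed i' k' = f ` (edge i k \<inter> edge i' k')"
      unfolding ed_def using edge_V that by (intro inj_on_image_Int[symmetric, OF f]) auto
    moreover have "edge i k \<inter> edge i' k' = {} \<longleftrightarrow> k \<noteq> k' \<and> P i k \<inter> P i' k' = {}"
      using d by (auto simp: edge_def Plus_def)
    ultimately show ?thesis by simp
  qed
  have P_disj: "P i k \<inter> P i k' = {}" if "i \<in> I" "k \<in> {1..t}" "k' \<in> {1..t}" "k \<noteq> k'" for i k k'
    using disjoint_family_onD[OF disj] that by blast
  have ed_card: "card (ed i k) = s + d" if "i \<in> I" "k \<in> {1..t}" for i k
  proof -
    have "card (ed i k) = card (edge i k)"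
      unfolding ed_def using edge_V[OF that] f by (intro card_image) (rule inj_on_subset)
    also have "\<dots> = s + d"
      using piece[OF that] X finite_subset[of "P i k" X] by (simp add: edge_def card_Plus)
    finally show ?thesis .
  qed
  have ed_inj: "inj_on (ed i) {1..t}" if "i \<in> I" for i
  proof (rule inj_onI, rule ccontr)
    fix k k' assume k: "k \<in> {1..t}" "k' \<in> {1..t}" "ed i k = ed i k'" "k \<noteq> k'"
    then have "ed i k \<inter> ed i k' = {}"
      using ed_Int P_disj that by metis
    \<comment> \<open>Impossible even for empty pieces: as \<open>d > 0\<close>, an edge meets
      itself in its private vertices.\<close>
    then have "ed i k \<inter> ed i k = {}"
      using k by simp
    then show False using ed_Int that k by blast
  qed
  obtain b where b: "bij_betw b {1..card I} I"
    using ex_bij_betw_nat_finite_1[OF I] by blast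
  have bI: "b n \<in> I" if "n \<in> {1..card I}" for n
    using b that by (auto simp: bij_betw_def)
  define M where "M = (\<lambda>n. ed (b n) ` {1..t})"
  define E where "E = (\<Union>i\<in>I. ed i ` {1..t})"
  have "uniform_hypergraph (s + d) (f ` V) E"
    unfolding uniform_hypergraph_def E_def
  proof (intro conjI ballI; (elim UN_E imageE)?)
    show "finite (f ` V)" using finV by simp
    fix e i k assume "i \<in> I" "k \<in> {1..t}" "e = ed i k"
    then show "e \<subseteq> f ` V" "card e = s + d"
      using ed_card image_mono[OF edge_V, of i k f] by (auto simp only: ed_def)
  qed
  moreover have "matching E (M n) \<and> card (M n) = t" if "n \<in> {1..card I}" for n
  proof -
    have "disjoint (M n)"
      unfolding M_def pairwise_def disjnt_def
    proof (intro ballI impI)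
      fix x y assume "x \<in> ed (b n) ` {1..t}" "y \<in> ed (b n) ` {1..t}" "x \<noteq> y"
      then obtain k k' where k: "k \<in> {1..t}" "k' \<in> {1..t}" "x = ed (b n) k" "y = ed (b n) k'" "k \<noteq> k'"
        by blast
      then show "x \<inter> y = {}"
        using ed_Int P_disj bI[OF that] by simp
    qed
    moreover have "M n \<subseteq> E"
      using bI[OF that] by (auto simp: M_def E_def)
    moreover have "card (M n) = t"
      unfolding M_def using ed_inj[OF bI[OF that]] by (simp add: card_image)
    ultimately show ?thesis by (simp add: matching_def)
  qed
  moreover have "\<not> has_rainbow_matching (card I) M t"
  proof
    assume "has_rainbow_matching (card I) M t"
    then obtain idx e where idx: "idx ` {1..t} \<subseteq> {1..card I}" "inj_on idx {1..t}"
      and e: "\<And>k. k \<in> {1..t} \<Longrightarrow> e k \<in> M (idx k)" and e_disj: "disjoint_family_on e {1..t}"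
      unfolding has_rainbow_matching_def by blast
    have "\<forall>k\<in>{1..t}. \<exists>c\<in>{1..t}. e k = ed (b (idx k)) c"
      using e unfolding M_def by blast
    then obtain c where c: "\<And>k. k \<in> {1..t} \<Longrightarrow> c k \<in> {1..t}"
      and ec: "\<And>k. k \<in> {1..t} \<Longrightarrow> e k = ed (b (idx k)) (c k)"
      by metis
    have iI: "b (idx k) \<in> I" if "k \<in> {1..t}" for k
      using idx(1) that by (intro bI) blast
    have pieces: "c k \<noteq> c l \<and> P (b (idx k)) (c k) \<inter> P (b (idx l)) (c l) = {}"
      if "k \<in> {1..t}" "l \<in> {1..t}" "k \<noteq> l" for k l
    proof -
      have "e k \<inter> e l = {}"
        using disjoint_family_onD[OF e_disj] that by blast
      then show ?thesis
        using ed_Int[OF iI[OF that(1)] c[OF that(1)] iI[OF that(2)] c[OF that(2)]] ec that by simp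
    qed
    have c_inj: "inj_on c {1..t}"
      by (rule inj_onI) (use pieces in blast)
    moreover have "c ` {1..t} \<subseteq> {1..t}"
      using c by blast
    ultimately have c_surj: "c ` {1..t} = {1..t}"
      by (intro endo_inj_surj) auto
    define g where "g = inv_into {1..t} c"
    have g: "g k \<in> {1..t}" "c (g k) = k" if "k \<in> {1..t}" for k
      using that c_surj inv_into_into[of k c "{1..t}"] f_inv_into_f[of k c "{1..t}"] by (auto simp: g_def)
    define j where "j = (\<lambda>k. b (idx (g k)))"
    have "j ` {1..t} \<subseteq> I"
      using g iI by (auto simp: j_def)
    moreover have "inj_on j {1..t}"
    proof (rule inj_onI)
      fix k l assume kl: "k \<in> {1..t}" "l \<in> {1..t}" "j k = j l"
      have "idx (g k) \<in> {1..card I}" "idx (g l) \<in> {1..card I}"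
        using g kl idx(1) by blast+
      then have "idx (g k) = idx (g l)"
        using kl(3) b unfolding j_def bij_betw_def inj_on_def by blast
      then have "g k = g l"
        using idx(2) g kl by (meson inj_onD)
      then show "k = l" using g kl by metis
    qed
    moreover have "disjoint_family_on (\<lambda>k. P (j k) k) {1..t}"
      unfolding disjoint_family_on_def
    proof (intro ballI impI)
      fix k l assume kl: "k \<in> {1..t}" "l \<in> {1..t}" "k \<noteq> l"
      then have "g k \<noteq> g l" using g by metis
      from pieces[OF g(1)[OF kl(1)] g(1)[OF kl(2)] this]
      show "P (j k) k \<inter> P (j l) l = {}"
        using g kl by (simp add: j_def)
    qed
    ultimately show False using free by blast
  qed
  ultimately show ?thesis
    unfolding rainbow_free_number_def by blast
qed

text \<open>If \<open>j 1\<close> misses the complement of \<open>j 2\<close>, it is contained in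
  \<open>j 2\<close>; equal sizes then force \<open>j 1 = j 2\<close>, against injectivity.\<close>

lemma rainbow_free_number_complements:
  assumes "d > 0"
  shows "rainbow_free_number (s + d) 2 ((2 * s) choose s)"
proof -
  define I where "I = {A. A \<subseteq> {..<2 * s} \<and> card A = s}"
  have "rainbow_free_number (s + d) 2 (card I)"
  proof (rule rainbow_free_number_pieces[where X = "{..<2 * s}" and P = "\<lambda>A k. if k = 1 then A else {..<2 * s} - A"])
    show "finite I" unfolding I_def by simp
    fix A k assume A: "A \<in> I" "k \<in> {1..2 :: nat}"
    then have "card ({..<2 * s} - A) = s"
      using finite_subset[of A "{..<2 * s}"] by (auto simp: I_def card_Diff_subset)
    then show "(if k = 1 then A else {..<2 * s} - A) \<subseteq> {..<2 * s} \<and> card (if k = 1 then A else {..<2 * s} - A) = s"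
      using A by (auto simp: I_def)
  next
    fix A assume "A \<in> I"
    then show "disjoint_family_on (\<lambda>k :: nat. if k = 1 then A else {..<2 * s} - A) {1..2}"
      by (auto simp: disjoint_family_on_def)
  next
    fix j assume j: "j ` {1..2 :: nat} \<subseteq> I" "inj_on j {1..2}"
    show "\<not> disjoint_family_on (\<lambda>k. if k = 1 then j k else {..<2 * s} - j k) {1..2 :: nat}"
    proof
      assume "disjoint_family_on (\<lambda>k. if k = 1 then j k else {..<2 * s} - j k) {1..2 :: nat}"
      from disjoint_family_onD[OF this, of 1 2]
      have "j 1 \<inter> ({..<2 * s} - j 2) = {}" by simp
      moreover have jI: "j 1 \<in> I" "j 2 \<in> I" using j(1) by auto
      ultimately have "j 1 \<subseteq> j 2" by (auto simp: I_def)
      then have "j 1 = j 2"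
        using jI by (intro card_subset_eq) (auto simp: I_def intro: finite_subset)
      then show False using inj_onD[OF j(2), of 1 2] by simp
    qed
  qed (use assms in auto)
  then show ?thesis by (simp add: I_def n_subsets)
qed

text \<open>Parts 1 and 2 extend over all zones, part \<open>z\<close> only over zone
  \<open>z\<close>. So zone \<open>z\<close> constrains just the partitions \<open>j 1\<close>,
  \<open>j 2\<close> and \<open>j z\<close>, and solvability there gives
  \<open>j 1 z = j 2 z\<close>; over all zones this makes \<open>j 1\<close> and \<open>j 2\<close>
  equal. The zone size \<open>t * s\<close> gives every part \<open>(t - 2) * s\<close>
  elements.\<close>

lemma rainbow_free_number_product:
  fixes X :: "'a set"
  assumes t: "t \<ge> 3" and X: "finite X" "card X = t * s" and d: "d > 0"
    and U: "U \<subseteq> {(A, B). A \<subseteq> X \<and> B \<subseteq> X \<and> card A = s \<and> card B = s \<and> A \<inter> B = {}}"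
    and solvable: "\<forall>(A, B)\<in>U. \<forall>(A', B')\<in>U. \<forall>(A'', B'')\<in>U.
       A \<inter> B' = {} \<longrightarrow> A \<union> B' = A'' \<union> B'' \<longrightarrow> A = A' \<and> B = B'"
  shows "rainbow_free_number ((t - 2) * s + d) t (card U ^ (t - 2))"
proof -
  define I where "I = (\<Pi>\<^sub>E z\<in>{3..t}. U)"
  define P where "P = (\<lambda>(f :: nat \<Rightarrow> 'a set \<times> 'a set) k.
    if k = 1 then SIGMA z:{3..t}. fst (f z)
    else if k = 2 then SIGMA z:{3..t}. snd (f z)
    else {k} \<times> (X - fst (f k) - snd (f k)))"
  have solv: "A = A' \<and> B = B'"
    if "(A, B) \<in> U" "(A', B') \<in> U" "(A'', B'') \<in> U" "A \<inter> B' = {}" "A \<union> B' = A'' \<union> B''" for A B A' B' A'' B''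
    using bspec[OF bspec[OF bspec[OF solvable that(1), unfolded prod.case] that(2), unfolded prod.case]
      that(3), unfolded prod.case] that(4,5) by blast
  have finU: "finite U"
    using U by (rule finite_subset) (rule finite_subset[of _ "Pow X \<times> Pow X"], use X in auto)
  have fU: "fst (f z) \<subseteq> X" "snd (f z) \<subseteq> X" "card (fst (f z)) = s" "card (snd (f z)) = s"
      "fst (f z) \<inter> snd (f z) = {}" "finite (fst (f z))" "finite (snd (f z))" "f z \<in> U"
    if "f \<in> I" "z \<in> {3..t}" for f z
  proof -
    show "f z \<in> U" using that by (auto simp: I_def)
    then have "f z \<in> {(A, B). A \<subseteq> X \<and> B \<subseteq> X \<and> card A = s \<and> card B = s \<and> A \<inter> B = {}}"
      by (rule subsetD[OF U])
    then show "fst (f z) \<subseteq> X" "snd (f z) \<subseteq> X" "card (fst (f z)) = s" "card (snd (f z)) = s"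
        "fst (f z) \<inter> snd (f z) = {}"
      by (auto simp: case_prod_beta)
    then show "finite (fst (f z))" "finite (snd (f z))"
      using X finite_subset by auto
  qed
  have "rainbow_free_number ((t - 2) * s + d) t (card I)"
  proof (rule rainbow_free_number_pieces[where X = "{3..t} \<times> X" and P = P])
    show "finite I" unfolding I_def using finU by (intro finite_PiE) auto
    show "finite ({3..t} \<times> X)" using X by simp
  next
    fix f k assume f: "f \<in> I" and k: "k \<in> {1..t}"
    consider "k = 1" | "k = 2" | "k \<in> {3..t}" using k by force
    then show "P f k \<subseteq> {3..t} \<times> X \<and> card (P f k) = (t - 2) * s"
    proof cases
      case 1
      have "(SIGMA z:{3..t}. fst (f z)) \<subseteq> {3..t} \<times> X"
        using fU(1)[OF f] by blast
      moreover have "card (SIGMA z:{3..t}. fst (f z)) = (t - 2) * s"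
        using fU[OF f] t by (subst card_SigmaI) auto
      ultimately show ?thesis using 1 by (simp add: P_def)
    next
      case 2
      have "(SIGMA z:{3..t}. snd (f z)) \<subseteq> {3..t} \<times> X"
        using fU(2)[OF f] by blast
      moreover have "card (SIGMA z:{3..t}. snd (f z)) = (t - 2) * s"
        using fU[OF f] t by (subst card_SigmaI) auto
      ultimately show ?thesis using 2 by (simp add: P_def)
    next
      case 3
      have "card (X - fst (f k) - snd (f k)) = card (X - (fst (f k) \<union> snd (f k)))"
        by (rule arg_cong[where f = card]) blast
      also have "\<dots> = card X - (s + s)"
        using fU[OF f 3] X by (subst card_Diff_subset) (auto simp: card_Un_disjoint)
      also have "\<dots> = (t - 2) * s"
        by (simp add: X diff_mult_distrib)
      finally show ?thesis
        using 3 by (auto simp: P_def card_cartesian_product)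
    qed
  next
    fix f assume "f \<in> I"
    then show "disjoint_family_on (P f) {1..t}"
      using fU(5)[of f] unfolding disjoint_family_on_def P_def by (auto; blast)
  next
    fix j assume j: "j ` {1..t} \<subseteq> I" "inj_on j {1..t}"
    show "\<not> disjoint_family_on (\<lambda>k. P (j k) k) {1..t}"
    proof
      assume "disjoint_family_on (\<lambda>k. P (j k) k) {1..t}"
      note D = disjoint_family_onD[OF this]
      have jI: "j k \<in> I" if "k \<in> {1..t}" for k using j(1) that by blast
      have j12: "j 1 \<in> I" "j 2 \<in> I" using jI t by auto
      have "j 1 z = j 2 z" if z: "z \<in> {3..t}" for z
      proof -
        have jz: "j z \<in> I" using jI z by simp
        \<comment> \<open>\<open>?C\<close> is the complement, within the zone, of part
          \<open>z\<close> of the partition \<open>j z\<close>. Disjointness pushes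
          \<open>?A\<close> and \<open>?B\<close> into \<open>?C\<close>, and they fill it by
          size.\<close>
        let ?A = "fst (j 1 z)" and ?B = "snd (j 2 z)" and ?C = "fst (j z z) \<union> snd (j z z)"
        have "(SIGMA z:{3..t}. fst (j 1 z)) \<inter> (SIGMA z:{3..t}. snd (j 2 z)) = {}"
          using D[of 1 2] t by (simp add: P_def)
        then have AB: "?A \<inter> ?B = {}" using z by blast
        have "(SIGMA z:{3..t}. fst (j 1 z)) \<inter> {z} \<times> (X - fst (j z z) - snd (j z z)) = {}"
          using D[of 1 z] t z by (simp add: P_def)
        then have A: "?A \<subseteq> ?C" using z fU(1)[OF j12(1) z] by blast
        have "(SIGMA z:{3..t}. snd (j 2 z)) \<inter> {z} \<times> (X - fst (j z z) - snd (j z z)) = {}"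
          using D[of 2 z] t z by (simp add: P_def)
        then have B: "?B \<subseteq> ?C" using z fU(2)[OF j12(2) z] by blast
        have "card (?A \<union> ?B) = s + s"
          using fU[OF j12(1) z] fU[OF j12(2) z] AB by (subst card_Un_disjoint) auto
        moreover have "card ?C = s + s"
          using fU[OF jz z] by (subst card_Un_disjoint) auto
        ultimately have un: "?A \<union> ?B = ?C"
          using A B fU(6,7)[OF jz z] by (intro card_subset_eq) auto
        have "fst (j 1 z) = fst (j 2 z) \<and> snd (j 1 z) = snd (j 2 z)"
          by (rule solv[OF _ _ _ AB un]) (use fU(8)[OF j12(1) z] fU(8)[OF j12(2) z] fU(8)[OF jz z] in simp_all)
        then show ?thesis by (simp add: prod_eq_iff)
      qed
      then have "j 1 = j 2"
        using j12 unfolding I_def by (intro PiE_ext)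
      then show False using inj_onD[OF j(2), of 1 2] t by simp
    qed
  qed (use d in auto)
  then show ?thesis
    by (simp add: I_def card_PiE)
qed

section \<open>Numerical estimates and choice of parameters\<close>

text \<open>The largest of the \<open>t * s + 1\<close> terms in the expansion of
  \<open>t ^ (t * s)\<close> is at least their average; dividing by its factor
  \<open>(t - 1) ^ ((t - 1) * s)\<close> gives the bound.\<close>

lemma central_multinomial_bound:
  assumes t: "t \<ge> 2"
  shows "(real t ^ t / (real t - 1) ^ (t - 1)) ^ s \<le> real (t * s + 1) * real ((t * s) choose s)"
proof -
  define q where "q = real t - 1"
  have q: "q > 0" and t_q: "real t = q + 1" and tq: "real (t - 1) = q"
    using t by (auto simp: q_def)
  define a where "a = (\<lambda>k. real ((t * s) choose k) * q ^ (t * s - k))"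
  \<comment> \<open>The terms of the expansion of \<open>(1 + q) ^ (t * s)\<close> are largest at \<open>k = s\<close>.\<close>
  have step: "q * real (Suc k) * a (Suc k) = real (t * s - k) * a k" if "k < t * s" for k
  proof -
    have "Suc k * ((t * s) choose Suc k) = (t * s - k) * ((t * s) choose k)"
      by (simp only: binomial_absorb_comp binomial_absorption)
    then have "real (Suc k) * real ((t * s) choose Suc k) = real (t * s - k) * real ((t * s) choose k)"
      by (metis of_nat_mult)
    moreover have "t * s - k = Suc (t * s - Suc k)" using that by simp
    then have "q ^ (t * s - k) = q * q ^ (t * s - Suc k)" by simp
    ultimately show ?thesis by (simp add: a_def)
  qed
  have a0: "a k \<ge> 0" for k using q by (simp add: a_def)
  have up: "a k \<le> a (Suc k)" if "Suc k \<le> s" for k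
  proof -
    have k: "k < t * s"
      using that t by (metis Suc_le_lessD less_le_trans mult_le_mono1 nat_mult_1 order_trans one_le_numeral)
    have "real k * q \<le> real s * q - q"
      using that q mult_right_mono[of "real k + 1" "real s" q] by (simp add: algebra_simps)
    then have "q * real (Suc k) \<le> real (t * s - k)"
      using k that by (simp add: of_nat_diff t_q algebra_simps)
    then have "q * real (Suc k) * a k \<le> real (t * s - k) * a k"
      using a0 by (intro mult_right_mono)
    with step[OF k] have "q * real (Suc k) * a k \<le> q * real (Suc k) * a (Suc k)" by simp
    then show ?thesis using q by simp
  qed
  have down: "a (Suc k) \<le> a k" if "s \<le> k" "k < t * s" for k
  proof -
    have "q * real s \<le> q * real k"
      using that q by (intro mult_left_mono) auto
    moreover have "real s \<le> real k" using that by simp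
    moreover have "real (t * s - k) = q * real s + real s - real k" "q * real (Suc k) = q * real k + q"
      using that by (simp_all add: of_nat_diff t_q algebra_simps)
    ultimately have "real (t * s - k) \<le> q * real (Suc k)"
      using q by linarith
    then have "real (t * s - k) * a k \<le> q * real (Suc k) * a k"
      using a0 by (intro mult_right_mono)
    with step[OF that(2)] have "q * real (Suc k) * a (Suc k) \<le> q * real (Suc k) * a k" by simp
    then show ?thesis using q by simp
  qed
  have max: "a k \<le> a s" if "k \<le> t * s" for k
  proof (cases "k \<le> s")
    case True
    then show ?thesis by (induction k rule: inc_induct) (auto intro: order_trans[OF up])
  next
    case False
    then have "s \<le> k" by simp
    then show ?thesis using that
      by (induction k rule: dec_induct) (auto intro: order_trans[OF down])
  qed
  have "real t ^ (t * s) = (1 + q) ^ (t * s)" by (simp add: t_q add.commute)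
  also have "\<dots> = (\<Sum>k\<le>t * s. a k)"
    by (subst binomial_ring) (simp add: a_def)
  also have "\<dots> \<le> (\<Sum>k\<le>t * s. a s)"
    using max by (intro sum_mono) auto
  also have "\<dots> = real (t * s + 1) * real ((t * s) choose s) * q ^ ((t - 1) * s)"
    by (simp add: a_def diff_mult_distrib)
  finally have "real t ^ (t * s) / q ^ ((t - 1) * s) \<le> real (t * s + 1) * real ((t * s) choose s)"
    using q by (simp add: field_simps)
  then show ?thesis
    by (simp add: q_def power_divide power_mult)
qed

text \<open>Behrend's trade-off: with \<open>m\<close> digits in base \<open>2 ^ (a + 1)\<close> and
  \<open>a\<close> at most a constant times \<open>m\<close>, restricting to the lower half of the
  digits costs \<open>2 ^ m\<close>, and restricting to one sphere costs a power of 2 with exponent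
  linear in \<open>m\<close>. For \<open>m\<close> of order \<open>sqrt s\<close> this is the
  claimed loss.\<close>

lemma uniquely_solvable_family_large:
  assumes t: "t \<ge> 3" and s: "s > 0" and m: "s \<le> m\<^sup>2"
  shows "\<exists>U \<subseteq> {(A, B). A \<subseteq> {..<t * s} \<and> B \<subseteq> {..<t * s} \<and> card A = s \<and> card B = s \<and> A \<inter> B = {}}.
    (t * s) choose s \<le> card U * 2 ^ ((2 * t + 5) * m + 4) \<and>
    (\<forall>(A, B)\<in>U. \<forall>(A', B')\<in>U. \<forall>(A'', B'')\<in>U.
       A \<inter> B' = {} \<longrightarrow> A \<union> B' = A'' \<union> B'' \<longrightarrow> A = A' \<and> B = B')"
proof -
  let ?C = "(t * s) choose s"
  define D where "D = (t * s - s) choose s"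
  have m0: "m > 0" using s m by (cases m) auto
  \<comment> \<open>A crude bound, used for the existence of \<open>a\<close> below and for
    \<open>a \<le> (t + 1) * m\<close>.\<close>
  have D_upper: "4 * D \<le> 2 ^ (((t + 1) * m + 1) * m)"
  proof -
    have "D \<le> (\<Sum>k\<le>t * s - s. (t * s - s) choose k)"
    proof (cases "s \<le> t * s - s")
      case True
      then show ?thesis unfolding D_def by (intro member_le_sum) auto
    next
      case False
      then show ?thesis by (simp add: D_def binomial_eq_0)
    qed
    also have "\<dots> = 2 ^ (t * s - s)" by (rule choose_row_sum)
    finally have "4 * D \<le> 2 ^ 2 * 2 ^ (t * s - s)" by simp
    also have "\<dots> = 2 ^ (2 + (t * s - s))" by (rule power_add[symmetric])
    also have "\<dots> \<le> 2 ^ (((t + 1) * m + 1) * m)"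
    proof (rule power_increasing)
      have "t * s - s \<le> t * m\<^sup>2" using m by (meson diff_le_self le_trans mult_le_mono2)
      moreover have "1 \<le> m\<^sup>2" "1 \<le> m" using m0 by auto
      moreover have "((t + 1) * m + 1) * m = t * m\<^sup>2 + m\<^sup>2 + m"
        by (simp add: power2_eq_square algebra_simps)
      ultimately show "2 + (t * s - s) \<le> ((t + 1) * m + 1) * m" by linarith
    qed simp
    finally show ?thesis .
  qed
  have D1: "D \<ge> 1"
  proof -
    have "2 * s \<le> t * s" using t by (intro mult_right_mono) auto
    then have "s \<le> t * s - s" by linarith
    then have "D > 0" unfolding D_def by (rule zero_less_binomial)
    then show ?thesis by simp
  qed
  \<comment> \<open>Minimality makes the modulus \<open>2 ^ ((a + 1) * m)\<close> exceed
    \<open>4 * D\<close> by a factor of at most \<open>2 ^ m\<close>.\<close>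
  define a where "a = (LEAST a. 4 * D \<le> 2 ^ ((a + 1) * m))"
  have a_ge: "4 * D \<le> 2 ^ ((a + 1) * m)" unfolding a_def
    by (rule LeastI[where P = "\<lambda>a. 4 * D \<le> 2 ^ ((a + 1) * m)", OF D_upper])
  have a_le: "a \<le> (t + 1) * m" unfolding a_def
    by (rule Least_le[where P = "\<lambda>a. 4 * D \<le> 2 ^ ((a + 1) * m)", OF D_upper])
  have a_least: "2 ^ ((a + 1) * m) \<le> 2 ^ m * (4 * D)"
  proof (cases a)
    case 0
    then show ?thesis using D1 by simp
  next
    case (Suc a')
    then have "\<not> 4 * D \<le> 2 ^ ((a' + 1) * m)"
      using not_less_Least[of a' "\<lambda>a. 4 * D \<le> 2 ^ ((a + 1) * m)"] by (simp add: a_def)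
    then have "2 ^ m * 2 ^ ((a' + 1) * m) \<le> 2 ^ m * (4 * D)" by simp
    then show ?thesis by (simp add: Suc power_add[symmetric] algebra_simps)
  qed
  define h where "h = (2 :: nat) ^ a"
  define p where "p = (2 * h) ^ m"
  \<comment> \<open>A power of 2 above the number of spheres: the factors absorb the added 1, the
    dimension \<open>m\<close>, and \<open>h\<^sup>2\<close>.\<close>
  define K where "K = (2 :: nat) ^ (1 + m + 2 * ((t + 1) * m))"
  have p_eq: "p = 2 ^ ((a + 1) * m)"
    unfolding p_def h_def power_Suc[symmetric] power_mult[symmetric] by simp
  obtain S where S: "S \<subseteq> {0..<int p}" "h ^ m \<le> card S * (m * h\<^sup>2 + 1)"
    and free: "\<forall>x\<in>S. \<forall>y\<in>S. \<forall>z\<in>S. [x + y = 2 * z] (mod int p) \<longrightarrow> x = y"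
    using behrend_set[of h m] unfolding p_def h_def by auto
  obtain U where U: "U \<subseteq> {(A, B). A \<subseteq> {..<t * s} \<and> B \<subseteq> {..<t * s} \<and> card A = s \<and> card B = s \<and> A \<inter> B = {}}"
    and U_card: "card S * (?C * D) \<le> card U * (2 * p\<^sup>2)"
    and U_solv: "\<forall>(A, B)\<in>U. \<forall>(A', B')\<in>U. \<forall>(A'', B'')\<in>U.
       A \<inter> B' = {} \<longrightarrow> A \<union> B' = A'' \<union> B'' \<longrightarrow> A = A' \<and> B = B'"
    using uniquely_solvable_family[of "{..<t * s}" s p S] s a_ge S(1) free
    unfolding D_def p_eq by auto
  have K: "m * h\<^sup>2 + 1 \<le> K"
  proof -
    have "m * h\<^sup>2 + 1 \<le> 2 * (m * h\<^sup>2)" using m0 by (simp add: h_def)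
    also have "\<dots> \<le> 2 * (2 ^ m * 2 ^ (2 * ((t + 1) * m)))"
    proof (intro mult_left_mono mult_mono)
      show "m \<le> 2 ^ m" by (simp add: less_imp_le)
      have "h\<^sup>2 = 2 ^ (2 * a)" by (simp add: h_def power_mult[symmetric] mult.commute)
      also have "\<dots> \<le> 2 ^ (2 * ((t + 1) * m))" using a_le by (intro power_increasing) auto
      finally show "h\<^sup>2 \<le> 2 ^ (2 * ((t + 1) * m))" .
    qed auto
    also have "\<dots> = K" unfolding K_def by (simp only: power_add power_one_right mult.assoc)
    finally show ?thesis .
  qed
  have p_S: "p \<le> 2 ^ m * (card S * K)"
  proof -
    have "h ^ m \<le> card S * K" using S(2) K by (meson le_trans mult_le_mono2)
    then show ?thesis by (simp add: p_def power_mult_distrib)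
  qed
  have p_D: "p \<le> 2 ^ m * (4 * D)" using a_least by (simp add: p_eq)
  \<comment> \<open>One factor \<open>p\<close> is traded for \<open>D\<close>, the other for
    \<open>card S\<close>. This rebuilds the left side of \<open>U_card\<close>, whose right side
    carries \<open>p\<^sup>2\<close>, so \<open>p * p\<close> cancels.\<close>
  have "?C * (p * p) \<le> ?C * ((2 ^ m * (4 * D)) * (2 ^ m * (card S * K)))"
    using p_S p_D by (intro mult_left_mono mult_mono) auto
  also have "\<dots> = (card S * (?C * D)) * (4 * 2 ^ m * 2 ^ m * K)" by (simp add: ac_simps)
  also have "\<dots> \<le> (card U * (2 * p\<^sup>2)) * (4 * 2 ^ m * 2 ^ m * K)"
    using U_card by (rule mult_right_mono) simp
  also have "\<dots> = card U * (2 * (4 * 2 ^ m * 2 ^ m * K)) * (p * p)"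
    by (simp add: power2_eq_square ac_simps)
  finally have "?C \<le> card U * (2 * (4 * 2 ^ m * 2 ^ m * K))"
    by (subst (asm) mult_le_cancel2) (simp add: p_def h_def)
  also have "2 * (4 * 2 ^ m * 2 ^ m * K) = 2 ^ (1 + 2 + m + m + (1 + m + 2 * ((t + 1) * m)))"
    unfolding K_def by (simp only: power_add) simp
  also have "1 + 2 + m + m + (1 + m + 2 * ((t + 1) * m)) = (2 * t + 5) * m + 4"
    by (simp add: algebra_simps)
  finally show ?thesis using U U_solv by (intro exI[of _ U] conjI)
qed

text \<open>As \<open>L \<ge> 2\<close>, the loss \<open>2 ^ (Q * m)\<close> is at most
  \<open>L ^ (Q * m)\<close> and moves into the exponent, at a cost of at most
  \<open>2 * Q * sqrt r\<close>; the missing \<open>t\<close> costs at most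
  \<open>t * sqrt r\<close>.\<close>

lemma powr_lower_bound_from_power:
  fixes L :: real
  assumes L: "L \<ge> 2" and N: "L ^ (r - t) \<le> N * 2 ^ (Q * m)" and m: "real m \<le> 2 * sqrt (real r)"
    and r: "r \<ge> t" "r \<ge> 1"
  shows "N \<ge> L powr (real r - real (2 * Q + t) * sqrt (real r))"
proof -
  have sq: "sqrt (real r) \<ge> 1" using r by simp
  have "real Q * real m \<le> real Q * (2 * sqrt (real r))" using m by (intro mult_left_mono) auto
  moreover have "real t * 1 \<le> real t * sqrt (real r)" using sq by (intro mult_left_mono) auto
  ultimately have "real r - real (2 * Q + t) * sqrt (real r) \<le> real (r - t) - real (Q * m)"
    using r by (simp add: of_nat_diff algebra_simps)
  then have "L powr (real r - real (2 * Q + t) * sqrt (real r)) \<le> L powr (real (r - t) - real (Q * m))"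
    using L by (intro powr_mono) auto
  also have "\<dots> = L ^ (r - t) / L ^ (Q * m)"
    using L by (simp only: powr_diff powr_realpow)
  also have "\<dots> \<le> L ^ (r - t) / 2 ^ (Q * m)"
    using L by (intro divide_left_mono power_mono) auto
  also have "\<dots> \<le> N"
    using N by (simp add: divide_le_eq)
  finally show ?thesis .
qed

lemma base_ge_2:
  assumes "t \<ge> 2"
  shows "real t ^ t / (real t - 1) ^ (t - 1) \<ge> 2"
proof -
  have "2 * (real t - 1) ^ (t - 1) \<le> real t * real t ^ (t - 1)"
    using assms by (intro mult_mono power_mono) auto
  also have "\<dots> = real t ^ t"
    using assms by (simp flip: power_Suc)
  finally show ?thesis using assms by (simp add: le_divide_eq)
qed

section \<open>Combination of the cases \<open>t = 2\<close> and \<open>t \<ge> 3\<close>\<close>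

theorem theorem1p4:
  fixes t :: nat
  assumes "t \<ge> 2"
  shows "\<exists>(C :: real) (r0 :: nat). C \<ge> 0 \<and>
    (\<forall>r\<ge>r0. real (F r t) \<ge>
      (real t ^ t / (real t - 1) ^ (t - 1)) powr (real r - C * sqrt (real r)))"
proof -
  define L where "L = real t ^ t / (real t - 1) ^ (t - 1)"
  have L: "L \<ge> 2" unfolding L_def by (rule base_ge_2[OF assms])
  \<comment> \<open>An integer \<open>m\<close> with \<open>r \<le> m\<^sup>2\<close> postpones the
    square root. The \<open>t\<close> subtracted in the exponent covers the private vertices and the
    rounding of \<open>r\<close> to whole zones.\<close>
  have "\<exists>Q. \<forall>r\<ge>t. \<forall>m. r \<le> m\<^sup>2 \<longrightarrow> L ^ (r - t) \<le> real (F r t) * 2 ^ (Q * m)"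
  proof (cases "t = 2")
    case True
    have "L ^ (r - t) \<le> real (F r t) * 2 ^ (4 * m)" if r: "r \<ge> t" and m: "r \<le> m\<^sup>2" for r m
    proof -
      \<comment> \<open>This leaves one private vertex per edge.\<close>
      define s where "s = r - 1"
      have r_eq: "r = s + 1" using r True by (simp add: s_def)
      have "t * s + 1 \<le> 2 ^ (4 * m)"
      proof -
        have m0: "m > 0" using r m True by (cases m) auto
        have "t * s + 1 \<le> 2 * m\<^sup>2" using m True by (simp add: r_eq)
        also have "\<dots> \<le> 2 ^ m * (2 ^ m * 2 ^ m)"
          unfolding power2_eq_square using m0 self_le_power[of 2 m]
          by (intro mult_mono) (auto intro: less_imp_le)
        also have "\<dots> \<le> 2 ^ (4 * m)"
          by (simp flip: power_add)
        finally show ?thesis .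
      qed
      then have "real (t * s + 1) \<le> 2 ^ (4 * m)"
        by (metis of_nat_le_iff of_nat_numeral of_nat_power)
      moreover have "(t * s) choose s \<le> F r t"
        using rainbow_free_number_complements[of 1 s] True by (intro F_is_maximum(2)) (auto simp: r_eq)
      ultimately have "real (t * s + 1) * real ((t * s) choose s) \<le> 2 ^ (4 * m) * real (F r t)"
        by (intro mult_mono) auto
      moreover have "L ^ s \<le> real (t * s + 1) * real ((t * s) choose s)"
        unfolding L_def by (rule central_multinomial_bound[OF assms])
      moreover have "L ^ (r - t) \<le> L ^ s"
        using L True by (intro power_increasing) (auto simp: s_def)
      ultimately show ?thesis by (simp add: mult.commute)
    qed
    then show ?thesis by blast
  next
    case False
    with assms have t: "t \<ge> 3" by simp
    \<comment> \<open>Per zone, \<open>t * s + 1\<close> costs the exponent \<open>t + 2 * m\<close>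
      and the density of \<open>U\<close> costs \<open>(2 * t + 5) * m + 4\<close>; bounding
      \<open>t + 4\<close> by \<open>(t + 4) * m\<close> gives \<open>(3 * t + 11) * m\<close>, and
      there are \<open>t - 2\<close> zones.\<close>
    let ?Q = "(3 * t + 11) * (t - 2)"
    have "L ^ (r - t) \<le> real (F r t) * 2 ^ (?Q * m)" if r: "r \<ge> t" and m: "r \<le> m\<^sup>2" for r m
    proof -
      \<comment> \<open>Dividing \<open>r - 1\<close> rather than \<open>r\<close> keeps at least
        one private vertex: \<open>d\<close> lies between 1 and \<open>t - 2\<close>.\<close>
      define s where "s = (r - 1) div (t - 2)"
      define d where "d = r - (t - 2) * s"
      have lt: "(t - 2) * s \<le> r - 1" unfolding s_def by simp
      have rem: "r - 1 < (t - 2) * s + (t - 2)"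
        using dividend_less_times_div[of "t - 2" "r - 1"] t unfolding s_def by linarith
      have d: "d > 0" "(t - 2) * s + d = r" using lt r t by (auto simp: d_def)
      have s0: "s > 0" using t r by (simp add: s_def div_greater_zero_iff)
      have "1 * s \<le> (t - 2) * s" using t by (intro mult_right_mono) auto
      then have sm: "s \<le> m\<^sup>2" using lt m by linarith
      have m0: "m > 0" using s0 sm by (cases m) auto
      obtain U where U: "U \<subseteq> {(A, B). A \<subseteq> {..<t * s} \<and> B \<subseteq> {..<t * s} \<and> card A = s \<and> card B = s \<and> A \<inter> B = {}}"
        and U_card: "(t * s) choose s \<le> card U * 2 ^ ((2 * t + 5) * m + 4)"
        and U_solv: "\<forall>(A, B)\<in>U. \<forall>(A', B')\<in>U. \<forall>(A'', B'')\<in>U.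
           A \<inter> B' = {} \<longrightarrow> A \<union> B' = A'' \<union> B'' \<longrightarrow> A = A' \<and> B = B'"
        using uniquely_solvable_family_large[OF t s0 sm] by auto
      have "rainbow_free_number r t (card U ^ (t - 2))"
        using rainbow_free_number_product[OF t _ _ d(1) U U_solv] d(2) by simp
      then have FU: "card U ^ (t - 2) \<le> F r t"
        using t by (intro F_is_maximum(2)) auto
      have "t * s + 1 \<le> 2 ^ (t + 2 * m)"
      proof -
        have "t * s + 1 \<le> (t + 1) * m\<^sup>2"
        proof -
          have "t * s \<le> t * m\<^sup>2" using sm by (rule mult_left_mono) simp
          moreover have "1 \<le> m\<^sup>2" using m0 by simp
          ultimately show ?thesis unfolding add_mult_distrib by linarith
        qed
        also have "\<dots> \<le> 2 ^ t * (2 ^ m * 2 ^ m)"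
        proof -
          have "t + 1 \<le> 2 ^ t" "m \<le> 2 ^ m" using less_exp[of t] less_exp[of m] by linarith+
          then show ?thesis unfolding power2_eq_square by (intro mult_mono) auto
        qed
        also have "\<dots> = 2 ^ (t + 2 * m)" by (simp add: power_add mult_2)
        finally show ?thesis .
      qed
      then have "(t * s + 1) * ((t * s) choose s) \<le> 2 ^ (t + 2 * m) * (card U * 2 ^ ((2 * t + 5) * m + 4))"
        using U_card by (intro mult_mono) auto
      also have "\<dots> = card U * 2 ^ (t + 2 * m + ((2 * t + 5) * m + 4))"
        by (simp add: power_add)
      also have "\<dots> \<le> card U * 2 ^ ((3 * t + 11) * m)"
      proof (intro mult_left_mono power_increasing)
        have "t + 4 \<le> (t + 4) * m" using m0 by simp
        then show "t + 2 * m + ((2 * t + 5) * m + 4) \<le> (3 * t + 11) * m"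
          by (simp add: algebra_simps)
      qed auto
      finally have "real (t * s + 1) * real ((t * s) choose s) \<le> real (card U * 2 ^ ((3 * t + 11) * m))"
        by (metis of_nat_le_iff of_nat_mult)
      with central_multinomial_bound[OF assms, of s]
      have "L ^ s \<le> real (card U * 2 ^ ((3 * t + 11) * m))"
        unfolding L_def by linarith
      then have "(L ^ s) ^ (t - 2) \<le> real (card U * 2 ^ ((3 * t + 11) * m)) ^ (t - 2)"
        using L by (intro power_mono) auto
      also have "\<dots> = real (card U ^ (t - 2)) * 2 ^ (?Q * m)"
        by (simp add: power_mult_distrib power_mult[symmetric] ac_simps)
      also have "\<dots> \<le> real (F r t) * 2 ^ (?Q * m)"
        using FU by (intro mult_right_mono) (simp_all only: of_nat_le_iff, simp)
      finally have "L ^ ((t - 2) * s) \<le> real (F r t) * 2 ^ (?Q * m)"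
        by (simp add: power_mult[symmetric] mult.commute)
      moreover have "L ^ (r - t) \<le> L ^ ((t - 2) * s)"
        using L rem t by (intro power_increasing) auto
      ultimately show ?thesis by linarith
    qed
    then show ?thesis by blast
  qed
  then obtain Q where Q: "\<And>r m. r \<ge> t \<Longrightarrow> r \<le> m\<^sup>2 \<Longrightarrow> L ^ (r - t) \<le> real (F r t) * 2 ^ (Q * m)"
    by blast
  have "real (F r t) \<ge> L powr (real r - real (2 * Q + t) * sqrt (real r))" if r: "r \<ge> t" for r
  proof -
    define m where "m = nat \<lceil>sqrt (real r)\<rceil>"
    have sq: "sqrt (real r) \<ge> 1" using r assms by simp
    have m: "sqrt (real r) \<le> real m" "real m \<le> sqrt (real r) + 1"
      unfolding m_def using sq by linarith+
    have "real r \<le> real (m\<^sup>2)"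
      using power_mono[OF m(1), of 2] by simp
    then have "r \<le> m\<^sup>2" by (simp only: of_nat_le_iff)
    moreover have "real m \<le> 2 * sqrt (real r)" using m(2) sq by linarith
    ultimately show ?thesis
      using r assms by (intro powr_lower_bound_from_power[OF L Q[OF r]]) auto
  qed
  then show ?thesis
    unfolding L_def by (intro exI[of _ "real (2 * Q + t)"] exI[of _ t]) auto
qed

end
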